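(* Let $(\omega_x)_{x\in\mathbb Z^2}$ be i.i.d. under $\mathbb P$ with $\mathbb E|\omega_0|^p<\infty$ for some $p>2$, $\mathrm{Var}(\omega_0)>0$, and $\mathbb P(\omega_0\ge c)=1$ for some $c>-\infty$. Let $\xi\in\mathrm{ri}\,\mathcal U$ with $\mathcal U_\xi=[\underline\xi,\overline\xi]$, and assume $\underline\xi,\xi,\overline\xi\in\mathcal D$. Let $B^\xi\in\mathscr K(\Omega)$ be the Busemann function in direction $\xi$, i.e. the stationary $L^1(\mathbb P)$ cocycle such that $\mathbb P$-a.s. $B^\xi(\omega,x,y)=\lim_{n\to\infty}(G_{x,v_n}(\omega)-G_{y,v_n}(\omega))$ for all $x,y\in\mathbb Z^2$ and every sequence $v_n\in\mathbb Z_+^2$ with $|v_n|_1\to\infty$ and $\underline\xi\cdot e_1\le\varliminf \frac{v_n\cdot e_1}{|v_n|_1}\le\varlimsup\frac{v_n\cdot e_1}{|v_n|_1}\le\overline\xi\cdot e_1$. One has $h(B^\xi)=-\nabla g_{\rm pp}(\xi)$. Define $F(x,y)=h(B^\xi)\cdot(x-y)-B^\xi(x,y)$. (i) Let $h=h(B^\xi)+(t,t)$ for some $t\in\mathbb R$. Then for $\mathbb P$-a.e. $\omega$ $$g_{\rm pl}(h)=\max_{i\in\{1,2\}}\{\omega_0+h\cdot e_i+F(\omega,0,e_i)\}=t .$$ In other words, $F$ is a minimizer in the formula $$g_{\rm pl}(h)=\inf_{F\in\mathscr K_0(\Omega)}\mathbb P\text{-}\operatorname*{ess\,sup}_\omega\max_{i\in\{1,2\}}\{\omega_0+h\cdot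 e_i+F(\omega,0,e_i)\}$$ and for it the essential supremum is not needed. (ii) For $\mathbb P$-a.e. $\omega$ $$g_{\rm pp}(\xi)=\max_{i\in\{1,2\}}\{\omega_0-B^\xi(\omega,0,e_i)-h(B^\xi)\cdot\xi\}.$$ In other words, $B^\xi$ is a minimizer in the formula $$g_{\rm pp}(\xi)=\inf_{B\in\mathscr K(\Omega)}\mathbb P\text{-}\operatorname*{ess\,sup}_\omega\max_{i\in\{1,2\}}\{\omega_0-B(\omega,0,e_i)-h(B)\cdot\xi\}$$ and for it the essential supremum is not needed.
   Context: Here $e_1=(1,0)$, $e_2=(0,1)$, $|x|_1$ is the $\ell^1$ norm, $x\le y$ is coordinatewise. $\Omega=\mathbb R^{\mathbb Z^2}$ is the space of weights $\omega=(\omega_x)$ with translations $(T_x\omega)_y=\omega_{x+y}$; $\mathbb P$ is a Borel probability measure on $\Omega$. Up-right paths have steps in $\{e_1,e_2\}$. For $x\le y$, $G_{x,y}=\max\sum_{k=0}^{n-1}\omega_{x_k}$ over up-right paths $x=x_0,\dots,x_n=y$, $n=|y-x|_1$. For $h\in\mathbb R^2$, $G_n(h)=\max\{\sum_{k=0}^{n-1}\omega_{x_k}+h\cdot x_n\}$ over $n$-step up-right paths with $x_0=0$. The a.s. deterministic limits are $g_{\rm pp}(\xi)=\lim n^{-1}G_{0,\lfloor n\xi\rfloor}$ ($\xi\in\mathbb R_+^2$) and $g_{\rm pl}(h)=\lim n^{-1}G_n(h)$; $g_{\rm pp}$ is continuous, concave, symmetric and 1-homogeneous. $\mathcal U=\{te_1+(1-t)e_2:t\in[0,1]\}$,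 $\mathrm{ri}\,\mathcal U$ is its relative interior ($t\in(0,1)$), $\mathcal D=\{\xi\in\mathrm{ri}\,\mathcal U: g_{\rm pp}\text{ is differentiable at }\xi\}$. One-sided gradients: $\nabla g_{\rm pp}(\zeta\pm)\cdot e_1=\lim_{\varepsilon\searrow0}\frac{g_{\rm pp}(\zeta\pm\varepsilon e_1)-g_{\rm pp}(\zeta)}{\pm\varepsilon}$, $\nabla g_{\rm pp}(\zeta\pm)\cdot e_2=\lim_{\varepsilon\searrow0}\frac{g_{\rm pp}(\zeta\mp\varepsilon e_2)-g_{\rm pp}(\zeta)}{\mp\varepsilon}$. $\mathcal U_{\xi\pm}=\{\zeta\in\mathrm{ri}\,\mathcal U: g_{\rm pp}(\zeta)-g_{\rm pp}(\xi)=\nabla g_{\rm pp}(\xi\pm)\cdot(\zeta-\xi)\}$ and $\mathcal U_\xi=\mathcal U_{\xi-}\cup\mathcal U_{\xi+}=[\underline\xi,\overline\xi]$ with $\underline\xi\cdot e_1\le\overline\xi\cdot e_1$. A stationary $L^1(\mathbb P)$ cocycle is a measurable $B:\Omega\times\mathbb Z^2\times\mathbb Z^2\to\mathbb R$ with $\mathbb E|B(0,e_i)|<\infty$ for $i=1,2$; $B(\omega,z+x,z+y)=B(T_z\omega,x,y)$ a.s. for all $x,y,z$; and $B(x,y)+B(y,z)=B(x,z)$ a.s. for all $x,y,z$. $\mathscr K(\Omega)$ is the space of these; $\mathscr K_0(\Omega)$ is the subspace of those with $\mathbb E[F(x,y)]=0$ for all $x,y$. For a cocycle $B$, $h(B)\in\mathbb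 R^2$ is defined by $\mathbb E[B(0,e_i)]=-h(B)\cdot e_i$, $i=1,2$. Under the differentiability hypotheses, the Busemann function $B^\xi$ described in the claim exists. The two displayed infimum formulas are known to hold for all $h\in\mathbb R^2$ and all $\xi\in\mathrm{ri}\,\mathcal U$. *)

theory Defs
  imports "HOL-Probability.Probability"
begin

type_synonym site = "int \<times> int"
type_synonym env = "site \<Rightarrow> real"
type_synonym cocycle = "env \<Rightarrow> site \<Rightarrow> site \<Rightarrow> real"

definition e1 :: site where "e1 = (1, 0)"
definition e2 :: site where "e2 = (0, 1)"

definition rvec :: "site \<Rightarrow> real \<times> real"
  where "rvec x = (real_of_int (fst x), real_of_int (snd x))"

definition l1norm :: "site \<Rightarrow> int"
  where "l1norm x = \<bar>fst x\<bar> + \<bar>snd x\<bar>"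

definition translate :: "site \<Rightarrow> env \<Rightarrow> env"
  where "translate x \<omega> = (\<lambda>y. \<omega> (x + y))"

subsection \<open>Last-passage times and their limits\<close>

definition up_right :: "nat \<Rightarrow> (nat \<Rightarrow> site) \<Rightarrow> bool"
  where "up_right n p \<longleftrightarrow> (\<forall>k<n. p (Suc k) - p k \<in> {e1, e2})"

text \<open>Only the values of a path \<open>p\<close> at times \<open>0, \<dots>, n\<close> matter, so the sets of passage times below
  are finite.  The value of \<open>lpp \<omega> x y\<close> is meaningful only if \<open>x \<le> y\<close> coordinatewise, since
  otherwise no up-right path leads from \<open>x\<close> to \<open>y\<close>.\<close>

definition lpp :: "env \<Rightarrow> site \<Rightarrow> site \<Rightarrow> real"
  where "lpp \<omega> x y = (let n = nat (l1norm (y - x)) in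
           Max {\<Sum>k<n. \<omega> (p k) | p. up_right n p \<and> p 0 = x \<and> p n = y})"

definition lpp_line :: "env \<Rightarrow> nat \<Rightarrow> real \<times> real \<Rightarrow> real"
  where "lpp_line \<omega> n h =
           Max {(\<Sum>k<n. \<omega> (p k)) + h \<bullet> rvec (p n) | p. up_right n p \<and> p 0 = 0}"

definition floor_vec :: "real \<times> real \<Rightarrow> site"
  where "floor_vec \<xi> = (\<lfloor>fst \<xi>\<rfloor>, \<lfloor>snd \<xi>\<rfloor>)"

text \<open>The following two predicates say that a deterministic function \<open>g\<close> gives the almost sure limits
  defining the point-to-point and the point-to-line time constant. Almost sure limits are
  unique, so \<open>g\<close> is determined on the nonnegative quadrant and on the whole plane,
  respectively.\<close>

definition is_gpp :: "env measure \<Rightarrow> (real \<times> real \<Rightarrow> real) \<Rightarrow> bool"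
  where "is_gpp P g \<longleftrightarrow> (\<forall>\<xi>. 0 \<le> fst \<xi> \<and> 0 \<le> snd \<xi> \<longrightarrow>
           (AE \<omega> in P. (\<lambda>n. lpp \<omega> 0 (floor_vec (real n *\<^sub>R \<xi>)) / real n) \<longlonglongrightarrow> g \<xi>))"

definition is_gpl :: "env measure \<Rightarrow> (real \<times> real \<Rightarrow> real) \<Rightarrow> bool"
  where "is_gpl P g \<longleftrightarrow> (\<forall>h. AE \<omega> in P. (\<lambda>n. lpp_line \<omega> n h / real n) \<longlonglongrightarrow> g h)"

subsection \<open>Directions and gradients\<close>

definition directions :: "(real \<times> real) set"
  where "directions = {t *\<^sub>R rvec e1 + (1 - t) *\<^sub>R rvec e2 | t. t \<in> {0..1}}"

definition diff_directions :: "(real \<times> real \<Rightarrow> real) \<Rightarrow> (real \<times> real) set"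
  where "diff_directions g = {\<xi> \<in> rel_interior directions. g differentiable (at \<xi>)}"

definition gradient :: "(real \<times> real \<Rightarrow> real) \<Rightarrow> real \<times> real \<Rightarrow> real \<times> real"
  where "gradient g \<xi> =
           (frechet_derivative g (at \<xi>) (rvec e1), frechet_derivative g (at \<xi>) (rvec e2))"

text \<open>The sign \<open>s\<close> is \<open>1\<close> for the gradient at \<open>\<zeta>+\<close> and \<open>-1\<close> for the gradient at \<open>\<zeta>-\<close>. The second
  coordinate moves in the opposite direction, because moving to the right along the
  segment of directions decreases it.\<close>

definition onesided_gradient :: "(real \<times> real \<Rightarrow> real) \<Rightarrow> real \<Rightarrow> real \<times> real \<Rightarrow> real \<times> real"
  where "onesided_gradient g s \<zeta> =
           (Lim (at_right 0) (\<lambda>\<epsilon>. (g (\<zeta> + (s * \<epsilon>) *\<^sub>R rvec e1) - g \<zeta>) / (s * \<epsilon>)),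
            Lim (at_right 0) (\<lambda>\<epsilon>. (g (\<zeta> - (s * \<epsilon>) *\<^sub>R rvec e2) - g \<zeta>) / (- (s * \<epsilon>))))"

definition linear_piece_side ::
    "(real \<times> real \<Rightarrow> real) \<Rightarrow> real \<Rightarrow> real \<times> real \<Rightarrow> (real \<times> real) set"
  where "linear_piece_side g s \<xi> =
           {\<zeta> \<in> rel_interior directions. g \<zeta> - g \<xi> = onesided_gradient g s \<xi> \<bullet> (\<zeta> - \<xi>)}"

definition linear_piece :: "(real \<times> real \<Rightarrow> real) \<Rightarrow> real \<times> real \<Rightarrow> (real \<times> real) set"
  where "linear_piece g \<xi> = linear_piece_side g (-1) \<xi> \<union> linear_piece_side g 1 \<xi>"

subsection \<open>Stationary cocycles\<close>

definition cocycles :: "env measure \<Rightarrow> cocycle set"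
  where "cocycles P = {B.
     (\<lambda>(\<omega>, x, y). B \<omega> x y) \<in> borel_measurable (P \<Otimes>\<^sub>M count_space UNIV \<Otimes>\<^sub>M count_space UNIV) \<and>
     (\<forall>e\<in>{e1, e2}. integrable P (\<lambda>\<omega>. B \<omega> 0 e)) \<and>
     (\<forall>x y z. AE \<omega> in P. B \<omega> (z + x) (z + y) = B (translate z \<omega>) x y) \<and>
     (\<forall>x y z. AE \<omega> in P. B \<omega> x y + B \<omega> y z = B \<omega> x z)}"

text \<open>The centering condition is written with \<^const>\<open>has_bochner_integral\<close> because the Bochner integral
  of a non-integrable function is \<open>0\<close> by convention.\<close>

definition centered_cocycles :: "env measure \<Rightarrow> cocycle set"
  where "centered_cocycles P =
           {F \<in> cocycles P. \<forall>x y. has_bochner_integral P (\<lambda>\<omega>. F \<omega> x y) 0}"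

definition hvec :: "env measure \<Rightarrow> cocycle \<Rightarrow> real \<times> real"
  where "hvec P B = (- (\<integral>\<omega>. B \<omega> 0 e1 \<partial>P), - (\<integral>\<omega>. B \<omega> 0 e2 \<partial>P))"

definition busemann_limit ::
    "env measure \<Rightarrow> real \<times> real \<Rightarrow> real \<times> real \<Rightarrow> cocycle \<Rightarrow> bool"
  where "busemann_limit P \<xi>l \<xi>r B \<longleftrightarrow>
     (AE \<omega> in P. \<forall>x y. \<forall>v :: nat \<Rightarrow> site.
        (\<forall>n. 0 \<le> fst (v n) \<and> 0 \<le> snd (v n)) \<longrightarrow>
        filterlim (\<lambda>n. l1norm (v n)) at_top sequentially \<longrightarrow>
        ereal (\<xi>l \<bullet> rvec e1) \<le> liminf (\<lambda>n. ereal (rvec (v n) \<bullet> rvec e1 / real_of_int (l1norm (v n)))) \<longrightarrow>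
        limsup (\<lambda>n. ereal (rvec (v n) \<bullet> rvec e1 / real_of_int (l1norm (v n)))) \<le> ereal (\<xi>r \<bullet> rvec e1) \<longrightarrow>
        (\<lambda>n. lpp \<omega> x (v n) - lpp \<omega> y (v n)) \<longlonglongrightarrow> B \<omega> x y)"

subsection \<open>The functionals in the variational formulas\<close>

definition pl_functional :: "real \<times> real \<Rightarrow> cocycle \<Rightarrow> env \<Rightarrow> real"
  where "pl_functional h F \<omega> = (MAX e\<in>{e1, e2}. \<omega> 0 + h \<bullet> rvec e + F \<omega> 0 e)"

definition pp_functional :: "env measure \<Rightarrow> real \<times> real \<Rightarrow> cocycle \<Rightarrow> env \<Rightarrow> real"
  where "pp_functional P \<xi> B \<omega> = (MAX e\<in>{e1, e2}. \<omega> 0 - B \<omega> 0 e - hvec P B \<bullet> \<xi>)"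

end

theory Submission
  imports Defs
begin

text \<open>
  Write \<open>h\<close> for the vector of the Busemann cocycle \<open>B\<close>.  Everything rests on
  \<open>gpp \<zeta> \<le> - (h \<bullet> \<zeta>)\<close> for all \<open>\<zeta>\<close> in the quadrant, with equality at \<open>\<xi>\<close>: since
  \<open>gpp\<close> is differentiable at \<open>\<xi>\<close>, this forces \<open>h\<close> to be minus its gradient there.

  For the upper bound, \<open>\<omega> 0 \<le> s + B' \<omega> 0 e\<close> for a cocycle \<open>B'\<close> telescopes along up-right paths to a
  bound on passage times, whose expectation is linear in the endpoint; Fatou's lemma (the weights
  are bounded below) transfers it to the almost sure limit.  This uses neither the ergodic theorem
  for cocycles nor the shape theorem.  It yields the lower bounds in both variational formulas, and
  with \<open>s = 0\<close> it applies to the Busemann cocycle, because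
  \<open>\<omega> 0 = min (B \<omega> 0 e1) (B \<omega> 0 e2)\<close> follows from the recursion for passage times.

  For the lower bound at \<open>\<xi>\<close>, the differences of passage times converging to \<open>B \<omega> 0 e\<close> are bounded
  below, so by Fatou and stationarity the expected passage time grows asymptotically by at least
  the mean of \<open>B \<omega> 0 e\<close> with every step \<open>e\<close> along a path in direction \<open>\<xi>\<close>; expected passage times are
  in turn bounded by the time constant through superadditivity.

  The point-to-line constant is compared with \<open>gpp\<close> on a finite grid of directions, which is enough
  because passage times are almost monotone in the endpoint.
\<close>

subsection \<open>Combinatorics of last-passage times\<close>

lemma up_right_endpoint:
  assumes "up_right n p"
  shows "p 0 \<le> p n" "l1norm (p n - p 0) = int n"
proof -
  have "p 0 \<le> p n \<and> l1norm (p n - p 0) = int n"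
    using assms
  proof (induction n)
    case (Suc n)
    then have "p 0 \<le> p n" "l1norm (p n - p 0) = int n"
      by (auto simp: up_right_def)
    moreover have "p (Suc n) = p n + e1 \<or> p (Suc n) = p n + e2"
      using Suc.prems by (auto simp: up_right_def algebra_simps)
    ultimately show ?case
      by (auto simp: l1norm_def e1_def e2_def less_eq_prod_def)
  qed (simp add: l1norm_def)
  then show "p 0 \<le> p n" "l1norm (p n - p 0) = int n" by auto
qed

lemma up_right_Suc:
  "up_right (Suc n) p \<longleftrightarrow> p 1 - p 0 \<in> {e1, e2} \<and> up_right n (\<lambda>k. p (Suc k))"
  unfolding up_right_def All_less_Suc2 by simp

lemma up_right_case_nat:
  assumes "up_right n q" "e \<in> {e1, e2}" "q 0 = x + e"
  shows "up_right (Suc n) (case_nat x q)"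
  using assms by (simp add: up_right_Suc)

lemma up_right_exists:
  assumes "x \<le> y"
  shows "\<exists>p. up_right (nat (l1norm (y - x))) p \<and> p 0 = x \<and> p (nat (l1norm (y - x))) = y"
  using assms
proof (induction "nat (l1norm (y - x))" arbitrary: x)
  case 0
  then have "y = x"
    by (auto simp: l1norm_def prod_eq_iff)
  then show ?case
    by (auto simp: up_right_def l1norm_def)
next
  case (Suc n)
  have "\<exists>e \<in> {e1, e2}. x + e \<le> y"
    using Suc.prems Suc.hyps(2) by (auto simp: l1norm_def e1_def e2_def less_eq_prod_def)
  then obtain e where e: "e \<in> {e1, e2}" "x + e \<le> y"
    by blast
  have n: "n = nat (l1norm (y - (x + e)))"
    using Suc.prems Suc.hyps(2) e by (auto simp: l1norm_def e1_def e2_def less_eq_prod_def)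
  obtain q where q: "up_right n q" "q 0 = x + e" "q n = y"
    using Suc.hyps(1)[OF n e(2)] n by auto
  have "up_right (Suc n) (case_nat x q)"
    using up_right_case_nat[OF q(1) e(1) q(2)] .
  then show ?case
    unfolding Suc.hyps(2)[symmetric] using q by (intro exI[of _ "case_nat x q"]) auto
qed

section \<open>Finite path sets and extremal paths\<close>

text \<open>Freezing a path after time \<open>n\<close> leaves only finitely many functions, so the
  maxima defining passage times become maxima over a finite index set that does not depend on the
  environment. Attainment and integrability follow from this.\<close>

definition paths :: "nat \<Rightarrow> site \<Rightarrow> (nat \<Rightarrow> site) set"
  where "paths n x = {p. up_right n p \<and> p 0 = x \<and> (\<forall>k>n. p k = p n)}"

text \<open>Induction on \<open>n\<close>: after its first step, a path of length
  \<open>n + 1\<close> is a path of length \<open>n\<close> from one of two neighbours, with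
  \<open>case_nat\<close> putting the starting point back.\<close>

lemma finite_paths: "finite (paths n x)"
proof (induction n arbitrary: x)
  case 0
  have "p k = x" if "p \<in> paths 0 x" for p k
    using that by (cases k) (auto simp: paths_def)
  then have "paths 0 x \<subseteq> {\<lambda>_. x}"
    by blast
  then show ?case
    using finite_subset by blast
next
  case (Suc n)
  have "paths (Suc n) x \<subseteq> (\<Union>e\<in>{e1, e2}. case_nat x ` paths n (x + e))"
  proof
    fix p assume p: "p \<in> paths (Suc n) x"
    let ?q = "\<lambda>k. p (Suc k)"
    have e: "p 1 - p 0 \<in> {e1, e2}" and "up_right n ?q" "p 0 = x" "\<forall>k>Suc n. p k = p (Suc n)"
      using p unfolding paths_def up_right_Suc by auto
    then have "?q \<in> paths n (x + (p 1 - p 0))"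
      by (simp add: paths_def)
    moreover have "p = case_nat x ?q"
      using p by (auto simp: paths_def fun_eq_iff split: nat.split)
    ultimately show "p \<in> (\<Union>e\<in>{e1, e2}. case_nat x ` paths n (x + e))"
      using e by blast
  qed
  then show ?case
    using Suc.IH by (meson finite.emptyI finite.insertI finite_UN finite_imageI finite_subset)
qed

lemma stopped_path:
  assumes "up_right n p"
  shows "(\<lambda>k. p (min k n)) \<in> paths n (p 0)"
  using assms by (auto simp: paths_def up_right_def min_def Suc_le_eq)

lemma lpp_eq_Max_paths:
  assumes "n = nat (l1norm (y - x))"
  shows "lpp \<omega> x y = Max ((\<lambda>p. \<Sum>k<n. \<omega> (p k)) ` {p \<in> paths n x. p n = y})"
proof -
  have "{\<Sum>k<n. \<omega> (p k) | p. up_right n p \<and> p 0 = x \<and> p n = y}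
      = (\<lambda>p. \<Sum>k<n. \<omega> (p k)) ` {p \<in> paths n x. p n = y}" (is "?L = ?R")
  proof
    show "?L \<subseteq> ?R"
    proof
      fix s assume "s \<in> ?L"
      then obtain p where p: "s = (\<Sum>k<n. \<omega> (p k))" "up_right n p" "p 0 = x" "p n = y"
        by blast
      have "s = (\<Sum>k<n. \<omega> (p (min k n)))"
        unfolding p(1) by (intro sum.cong) auto
      then show "s \<in> ?R"
        using stopped_path[OF p(2)] p(3,4) by (intro image_eqI[of _ _ "\<lambda>k. p (min k n)"]) auto
    qed
  qed (auto simp: paths_def)
  then show ?thesis
    using assms by (simp add: lpp_def Let_def)
qed

lemma lpp_line_eq_Max_paths:
  "lpp_line \<omega> n h = Max ((\<lambda>p. (\<Sum>k<n. \<omega> (p k)) + h \<bullet> rvec (p n)) ` paths n 0)"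
proof -
  have "{(\<Sum>k<n. \<omega> (p k)) + h \<bullet> rvec (p n) | p. up_right n p \<and> p 0 = 0}
      = (\<lambda>p. (\<Sum>k<n. \<omega> (p k)) + h \<bullet> rvec (p n)) ` paths n 0" (is "?L = ?R")
  proof
    show "?L \<subseteq> ?R"
    proof
      fix s assume "s \<in> ?L"
      then obtain p where p: "s = (\<Sum>k<n. \<omega> (p k)) + h \<bullet> rvec (p n)" "up_right n p" "p 0 = 0"
        by blast
      have "s = (\<Sum>k<n. \<omega> (p (min k n))) + h \<bullet> rvec (p (min n n))"
        unfolding p(1) by (intro arg_cong2[where f = "(+)"] sum.cong) auto
      then show "s \<in> ?R"
        using stopped_path[OF p(2)] p(3) by (intro image_eqI[of _ _ "\<lambda>k. p (min k n)"]) auto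
    qed
  qed (auto simp: paths_def)
  then show ?thesis
    by (simp add: lpp_line_def)
qed

lemma lpp_ge_path:
  assumes "up_right n p"
  shows "(\<Sum>k<n. \<omega> (p k)) \<le> lpp \<omega> (p 0) (p n)"
proof -
  have n: "n = nat (l1norm (p n - p 0))"
    using up_right_endpoint[OF assms] by simp
  have "(\<Sum>k<n. \<omega> (p k)) = (\<Sum>k<n. \<omega> (p (min k n)))"
    by (intro sum.cong) auto
  then show ?thesis
    unfolding lpp_eq_Max_paths[OF n] using stopped_path[OF assms] finite_paths
    by (intro Max_ge) (auto intro!: image_eqI[of _ _ "\<lambda>k. p (min k n)"])
qed

lemma paths_nonempty:
  assumes "x \<le> y" "n = nat (l1norm (y - x))"
  shows "{p \<in> paths n x. p n = y} \<noteq> {}"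
proof -
  obtain p where "up_right n p" "p 0 = x" "p n = y"
    using up_right_exists[OF assms(1)] assms(2) by blast
  then show ?thesis
    using stopped_path[of n p] by auto
qed

lemma lpp_attained:
  assumes "x \<le> y"
  obtains p n where "n = nat (l1norm (y - x))" "up_right n p" "p 0 = x" "p n = y"
    "lpp \<omega> x y = (\<Sum>k<n. \<omega> (p k))"
proof -
  define n where "n = nat (l1norm (y - x))"
  have "lpp \<omega> x y \<in> (\<lambda>p. \<Sum>k<n. \<omega> (p k)) ` {p \<in> paths n x. p n = y}"
    unfolding lpp_eq_Max_paths[OF n_def] using paths_nonempty[OF assms n_def] finite_paths
    by (intro Max_in) auto
  then show thesis
    using that n_def by (auto simp: paths_def)
qed

lemma lpp_refl [simp]: "lpp \<omega> x x = 0"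
proof -
  obtain p n where "n = nat (l1norm (x - x))" "lpp \<omega> x x = (\<Sum>k<n. \<omega> (p k))"
    by (rule lpp_attained[of x x \<omega>]) auto
  then show ?thesis
    by (simp add: l1norm_def)
qed

section \<open>Superadditivity, first-step recursion and one-sided bounds\<close>

text \<open>Concatenate optimal paths. Passage times leave out the last weight, so the weight at
  \<open>y\<close> is not counted twice.\<close>

lemma lpp_superadditive:
  assumes "x \<le> y" "y \<le> z"
  shows "lpp \<omega> x y + lpp \<omega> y z \<le> lpp \<omega> x z"
proof -
  obtain p n where p: "up_right n p" "p 0 = x" "p n = y" "lpp \<omega> x y = (\<Sum>k<n. \<omega> (p k))"
    by (rule lpp_attained[OF assms(1), where \<omega>=\<omega>]) auto
  obtain q m where q: "up_right m q" "q 0 = y" "q m = z" "lpp \<omega> y z = (\<Sum>k<m. \<omega> (q k))"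
    by (rule lpp_attained[OF assms(2), where \<omega>=\<omega>]) auto
  define r where "r k = (if k < n then p k else q (k - n))" for k
  have step: "r (Suc k) - r k \<in> {e1, e2}" if "k < n + m" for k
  proof (cases "k < n")
    case True
    \<comment> \<open>At the junction \<open>Suc k = n\<close> the value comes from
      \<open>q 0\<close>, which agrees with \<open>p n\<close>.\<close>
    have "r (Suc k) = p (Suc k)"
      using True p(3) q(2) by (cases "Suc k = n") (auto simp: r_def)
    then show ?thesis
      using True p(1) by (auto simp: r_def up_right_def)
  next
    case False
    then show ?thesis
      using that q(1) by (auto simp: r_def up_right_def Suc_diff_le)
  qed
  have "(\<Sum>k<n + m. \<omega> (r k)) = (\<Sum>k<n. \<omega> (r k)) + (\<Sum>k<m. \<omega> (r (n + k)))"
    by (induction m) auto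
  also have "\<dots> = lpp \<omega> x y + lpp \<omega> y z"
    by (simp add: r_def p(4) q(4))
  finally have "lpp \<omega> x y + lpp \<omega> y z = (\<Sum>k<n + m. \<omega> (r k))" ..
  also have "\<dots> \<le> lpp \<omega> (r 0) (r (n + m))"
    using step unfolding up_right_def[symmetric] by (intro lpp_ge_path) (simp add: up_right_def)
  also have "r 0 = x"
    using p q by (cases n) (auto simp: r_def)
  also have "r (n + m) = z"
    using q by (simp add: r_def)
  finally show ?thesis .
qed

lemma lpp_unit_step:
  assumes "e \<in> {e1, e2}"
  shows "\<omega> x \<le> lpp \<omega> x (x + e)"
proof -
  have "up_right 1 (case_nat x (\<lambda>_. x + e))"
    using assms by (simp add: up_right_def)
  then show ?thesis
    using lpp_ge_path[of 1 "case_nat x (\<lambda>_. x + e)" \<omega>] by simp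
qed

lemma e_nonneg: "e \<in> {e1, e2} \<Longrightarrow> (0 :: site) \<le> e"
  by (auto simp: e1_def e2_def less_eq_prod_def)

lemma lpp_first_step_ge:
  assumes "e \<in> {e1, e2}" "x + e \<le> y"
  shows "\<omega> x + lpp \<omega> (x + e) y \<le> lpp \<omega> x y"
proof -
  have "x \<le> x + e"
    using e_nonneg[OF assms(1)] by (simp add: less_eq_prod_def)
  then show ?thesis
    using lpp_superadditive[OF _ assms(2), of x \<omega>] lpp_unit_step[OF assms(1), of \<omega> x] by simp
qed

lemma lpp_first_step_le:
  assumes "x \<le> y" "x \<noteq> y"
  shows "\<exists>e\<in>{e1, e2}. lpp \<omega> x y \<le> \<omega> x + lpp \<omega> (x + e) y"
proof -
  obtain p n where p: "up_right n p" "p 0 = x" "p n = y" "lpp \<omega> x y = (\<Sum>k<n. \<omega> (p k))"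
    by (rule lpp_attained[OF assms(1), where \<omega>=\<omega>]) auto
  then obtain m where m: "n = Suc m"
    using assms(2) by (cases n) auto
  have "p 1 - p 0 \<in> {e1, e2}" and q: "up_right m (\<lambda>k. p (Suc k))"
    using p(1) m by (simp_all add: up_right_Suc)
  moreover have "lpp \<omega> x y = \<omega> x + (\<Sum>k<m. \<omega> (p (Suc k)))"
    unfolding p(4) m sum.lessThan_Suc_shift using p(2) by simp
  moreover have "(\<Sum>k<m. \<omega> (p (Suc k))) \<le> lpp \<omega> (p (Suc 0)) (p (Suc m))"
    using lpp_ge_path[OF q, of \<omega>] .
  ultimately show ?thesis
    using p(2,3) m by (intro bexI[of _ "p 1 - p 0"]) auto
qed

text \<open>Dynamic programming. Both neighbours must lie below \<open>y\<close>, since a passage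
  time to a point that cannot be reached is a maximum over the empty set.\<close>

lemma lpp_eq_max:
  assumes "x + e1 \<le> y" "x + e2 \<le> y"
  shows "lpp \<omega> x y = \<omega> x + max (lpp \<omega> (x + e1) y) (lpp \<omega> (x + e2) y)"
proof -
  have "x \<le> y" "x \<noteq> y"
    using assms by (auto simp: e1_def e2_def less_eq_prod_def)
  then have "lpp \<omega> x y \<le> \<omega> x + lpp \<omega> (x + e1) y \<or> lpp \<omega> x y \<le> \<omega> x + lpp \<omega> (x + e2) y"
    using lpp_first_step_le[of x y \<omega>] by blast
  moreover have "\<omega> x + lpp \<omega> (x + e1) y \<le> lpp \<omega> x y" "\<omega> x + lpp \<omega> (x + e2) y \<le> lpp \<omega> x y"
    using lpp_first_step_ge[of e1 x y \<omega>] lpp_first_step_ge[of e2 x y \<omega>] assms by simp_all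
  ultimately show ?thesis
    by linarith
qed

text \<open>The increments of \<open>b\<close> dominate the weights and telescope along an optimal
  path. Cocycles supply such potentials later.\<close>

lemma lpp_le_potential:
  assumes "x \<le> y" "\<And>z e. e \<in> {e1, e2} \<Longrightarrow> \<omega> z \<le> b (z + e) - b z"
  shows "lpp \<omega> x y \<le> b y - b x"
proof -
  obtain p n where p: "up_right n p" "p 0 = x" "p n = y" "lpp \<omega> x y = (\<Sum>k<n. \<omega> (p k))"
    by (rule lpp_attained[OF assms(1), where \<omega>=\<omega>]) auto
  have "(\<Sum>k<n. \<omega> (p k)) \<le> (\<Sum>k<n. b (p (Suc k)) - b (p k))"
  proof (rule sum_mono)
    fix k assume "k \<in> {..<n}"
    then show "\<omega> (p k) \<le> b (p (Suc k)) - b (p k)"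
      using assms(2)[of "p (Suc k) - p k" "p k"] p(1) by (auto simp: up_right_def)
  qed
  also have "\<dots> = b (p n) - b (p 0)"
    by (rule sum_lessThan_telescope)
  finally show ?thesis
    using p by simp
qed

lemma lpp_ge_const:
  assumes "x \<le> y" "\<And>z. - c \<le> \<omega> z"
  shows "- c * real_of_int (l1norm (y - x)) \<le> lpp \<omega> x y"
proof -
  obtain p n where p: "n = nat (l1norm (y - x))" "lpp \<omega> x y = (\<Sum>k<n. \<omega> (p k))"
    by (rule lpp_attained[OF assms(1), where \<omega>=\<omega>]) auto
  have "- c * real_of_int (l1norm (y - x)) = (\<Sum>k<n. - c)"
    using p(1) by (simp add: l1norm_def)
  also have "\<dots> \<le> (\<Sum>k<n. \<omega> (p k))"
    by (intro sum_mono assms)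
  finally show ?thesis
    using p by simp
qed

text \<open>Prolonging an optimal path from \<open>y\<close> to \<open>z\<close> loses at most
  \<open>c\<close> per step.\<close>

lemma lpp_mono_endpoint:
  assumes "x \<le> y" "y \<le> z" "\<And>u. - c \<le> \<omega> u"
  shows "lpp \<omega> x y \<le> lpp \<omega> x z + c * real_of_int (l1norm (z - y))"
  using lpp_superadditive[OF assms(1,2), of \<omega>] lpp_ge_const[OF assms(2), of c \<omega>] assms(3) by simp

lemma lpp_translate: "lpp (translate z \<omega>) x y = lpp \<omega> (z + x) (z + y)"
proof -
  have *: "(z + y) - (z + x) = y - x"
    by simp
  define n where "n = nat (l1norm (y - x))"
  have "{\<Sum>k<n. translate z \<omega> (p k) | p. up_right n p \<and> p 0 = x \<and> p n = y}
     = {\<Sum>k<n. \<omega> (p k) | p. up_right n p \<and> p 0 = z + x \<and> p n = z + y}" (is "?L = ?R")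
  proof
    show "?L \<subseteq> ?R"
    proof
      fix s assume "s \<in> ?L"
      then obtain p where "s = (\<Sum>k<n. translate z \<omega> (p k))" "up_right n p" "p 0 = x" "p n = y"
        by blast
      then show "s \<in> ?R"
        by (intro CollectI exI[of _ "\<lambda>k. z + p k"]) (auto simp: translate_def up_right_def)
    qed
    show "?R \<subseteq> ?L"
    proof
      fix s assume "s \<in> ?R"
      then obtain p where "s = (\<Sum>k<n. \<omega> (p k))" "up_right n p" "p 0 = z + x" "p n = z + y"
        by blast
      then show "s \<in> ?L"
        by (intro CollectI exI[of _ "\<lambda>k. p k - z"]) (auto simp: translate_def up_right_def)
    qed
  qed
  then show ?thesis
    unfolding lpp_def * Let_def n_def by simp
qed

section \<open>Point-to-line passage times through their endpoints\<close>

lemma lpp_line_ge: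
  assumes "up_right n p" "p 0 = 0"
  shows "(\<Sum>k<n. \<omega> (p k)) + h \<bullet> rvec (p n) \<le> lpp_line \<omega> n h"
proof -
  have "(\<Sum>k<n. \<omega> (p k)) + h \<bullet> rvec (p n) = (\<Sum>k<n. \<omega> (p (min k n))) + h \<bullet> rvec (p (min n n))"
    by (intro arg_cong2[where f = "(+)"] sum.cong) auto
  then show ?thesis
    unfolding lpp_line_eq_Max_paths using stopped_path[OF assms(1)] assms(2) finite_paths
    by (intro Max_ge) (auto intro!: image_eqI[of _ _ "\<lambda>k. p (min k n)"])
qed

lemma lpp_line_ge_lpp:
  assumes "0 \<le> x" "n = nat (l1norm x)"
  shows "lpp \<omega> 0 x + h \<bullet> rvec x \<le> lpp_line \<omega> n h"
proof -
  obtain p m where p: "m = nat (l1norm (x - 0))" "up_right m p" "p 0 = 0" "p m = x"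
    "lpp \<omega> 0 x = (\<Sum>k<m. \<omega> (p k))"
    by (rule lpp_attained[OF assms(1), where \<omega>=\<omega>]) auto
  then show ?thesis
    using lpp_line_ge[of m p \<omega> h] assms(2) by simp
qed

lemma lpp_line_le_lpp:
  obtains x where "0 \<le> x" "l1norm x = int n" "lpp_line \<omega> n h \<le> lpp \<omega> 0 x + h \<bullet> rvec x"
proof -
  \<comment> \<open>The horizontal path shows that the maximum is over a nonempty set.\<close>
  have "(\<lambda>k. (int k, 0)) \<in> {p. up_right n p \<and> p 0 = 0}"
    by (auto simp: up_right_def e1_def zero_prod_def)
  then have "paths n 0 \<noteq> {}"
    using stopped_path[of n "\<lambda>k. (int k, 0)"] by auto
  then have "lpp_line \<omega> n h \<in> (\<lambda>p. (\<Sum>k<n. \<omega> (p k)) + h \<bullet> rvec (p n)) ` paths n 0"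
    unfolding lpp_line_eq_Max_paths using finite_paths by (intro Max_in) auto
  then obtain p where p: "up_right n p" "p 0 = 0"
    "lpp_line \<omega> n h = (\<Sum>k<n. \<omega> (p k)) + h \<bullet> rvec (p n)"
    by (auto simp: paths_def)
  then show thesis
    using that[of "p n"] up_right_endpoint[OF p(1)] lpp_ge_path[OF p(1), of \<omega>] by auto
qed

subsection \<open>Stationary environments and cocycles\<close>

text \<open>Fatou's lemma with an explicit minorant: the minimum of \<open>X n\<close> and
  \<open>Y\<close> is dominated by \<open>\<bar>C\<bar> + \<bar>Y\<bar>\<close> and tends to
  \<open>Y\<close>, so its expectation serves as \<open>b n\<close>. In this form no upper bound on
  the expectations of \<open>X n\<close> is asked for.\<close>

lemma (in prob_space) fatou_lower_bound:
  fixes X :: "nat \<Rightarrow> 'a \<Rightarrow> real"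
  assumes X: "\<And>n. integrable M (X n)" and Y: "integrable M Y"
    and lower: "\<And>n. AE w in M. - C \<le> X n w"
    and lim: "AE w in M. (\<lambda>n. X n w) \<longlonglongrightarrow> Y w"
  obtains b where "b \<longlonglongrightarrow> expectation Y" "\<And>n. b n \<le> expectation (X n)"
proof
  show "(\<lambda>n. expectation (\<lambda>w. min (X n w) (Y w))) \<longlonglongrightarrow> expectation Y"
  proof (rule integral_dominated_convergence)
    show "integrable M (\<lambda>w. \<bar>C\<bar> + \<bar>Y w\<bar>)"
      using Y by simp
    show "AE w in M. (\<lambda>n. min (X n w) (Y w)) \<longlonglongrightarrow> Y w"
      using lim
    proof eventually_elim
      case (elim w)
      then show ?case
        using tendsto_min[OF elim tendsto_const[of "Y w"]] by simp
    qed
    show "AE w in M. norm (min (X n w) (Y w)) \<le> \<bar>C\<bar> + \<bar>Y w\<bar>" for n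
      using lower[of n] by eventually_elim auto
  qed (use X Y in auto)
  show "expectation (\<lambda>w. min (X n w) (Y w)) \<le> expectation (X n)" for n
    using X Y by (intro integral_mono) auto
qed

lemma tendsto_floor_div:
  "(\<lambda>n. real_of_int \<lfloor>real n * a\<rfloor> / real n) \<longlonglongrightarrow> a"
proof (rule tendsto_sandwich)
  show "\<forall>\<^sub>F n in sequentially. a - 1 / real n \<le> real_of_int \<lfloor>real n * a\<rfloor> / real n"
    using eventually_gt_at_top[of 0]
  proof eventually_elim
    case (elim n)
    have "real n * a - 1 \<le> real_of_int \<lfloor>real n * a\<rfloor>"
      by linarith
    then have "(real n * a - 1) / real n \<le> real_of_int \<lfloor>real n * a\<rfloor> / real n"
      by (rule divide_right_mono) simp
    then show ?case
      using elim by (simp add: diff_divide_distrib)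
  qed
  show "\<forall>\<^sub>F n in sequentially. real_of_int \<lfloor>real n * a\<rfloor> / real n \<le> a"
    using eventually_gt_at_top[of 0] by eventually_elim (simp add: field_simps)
  show "(\<lambda>n. a - 1 / real n) \<longlonglongrightarrow> a"
    using tendsto_diff[OF tendsto_const lim_1_over_n, of a] by simp
qed simp

lemma continuous_translate: "continuous_on UNIV (translate z)"
  unfolding translate_def
  by (intro continuous_on_coordinatewise_then_product continuous_on_product_coordinates)

lemma inner_rvec_e:
  "h \<bullet> rvec e1 = fst h" "h \<bullet> rvec e2 = snd h"
  by (simp_all add: rvec_def e1_def e2_def inner_prod_def)

lemma rvec_diff: "rvec (x - y) = rvec x - rvec y"
  by (simp add: rvec_def)

lemma rvec_zero [simp]: "rvec 0 = 0"
  by (simp add: rvec_def zero_prod_def)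

text \<open>The setting of all estimates: a translation-invariant law with integrable weights
  bounded below by \<open>- c\<close>. With \<open>c\<close> nonnegative, \<open>c\<close> times a
  length bounds the loss caused by an additional piece of path.\<close>

locale stationary_weights = prob_space P for P :: "env measure" +
  fixes c :: real
  assumes sets_P: "sets P = sets borel"
    and distr_translate: "distr P P (translate z) = P"
    and integrable_weight_0: "integrable P (\<lambda>\<omega>. \<omega> 0)"
    and weight_0_ge: "AE \<omega> in P. - c \<le> \<omega> 0"
    and c_nonneg: "0 \<le> c"
begin

lemma measurable_translate: "translate z \<in> measurable P P"
  using borel_measurable_continuous_onI[OF continuous_translate[of z]]
    measurable_cong_sets[OF sets_P sets_P] by simp

lemma AE_translate:
  assumes "AE \<omega> in P. Q \<omega>"
  shows "AE \<omega> in P. Q (translate z \<omega>)"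
  by (rule AE_distrD[OF measurable_translate]) (simp only: distr_translate assms)

lemma has_integral_translate:
  assumes "has_bochner_integral P f (a :: real)"
  shows "has_bochner_integral P (\<lambda>\<omega>. f (translate z \<omega>)) a"
  using assms integrable_distr[OF measurable_translate[of z], of f]
    integral_distr[OF measurable_translate[of z], of f]
  by (auto simp: distr_translate has_bochner_integral_iff)

lemma integrable_weight: "integrable P (\<lambda>\<omega>. \<omega> x)"
  using has_integral_translate[of "\<lambda>\<omega>. \<omega> 0" _ x] integrable_weight_0
  by (auto simp: has_bochner_integral_iff translate_def)

lemma weight_ge: "AE \<omega> in P. \<forall>x. - c \<le> \<omega> x"
  unfolding AE_all_countable using AE_translate[OF weight_0_ge] by (simp add: translate_def)

lemma integrable_lpp: "x \<le> y \<Longrightarrow> integrable P (\<lambda>\<omega>. lpp \<omega> x y)"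
  unfolding lpp_eq_Max_paths[OF refl]
  using paths_nonempty[OF _ refl, of x y] finite_paths integrable_weight
  by (intro integrable_MAX) auto

lemma expectation_lpp_shift:
  assumes "x \<le> y"
  shows "expectation (\<lambda>\<omega>. lpp \<omega> (z + x) (z + y)) = expectation (\<lambda>\<omega>. lpp \<omega> x y)"
  using has_integral_translate[of "\<lambda>\<omega>. lpp \<omega> x y" _ z] integrable_lpp[OF assms]
  by (auto simp: has_bochner_integral_iff lpp_translate)

section \<open>Means of stationary cocycles\<close>

lemma cocycle_additive:
  assumes "B \<in> cocycles P"
  shows "AE \<omega> in P. \<forall>x y z. B \<omega> x y + B \<omega> y z = B \<omega> x z"
  using assms by (simp add: AE_all_countable cocycles_def)

lemma measurable_cocycle:
  assumes "B \<in> cocycles P"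
  shows "(\<lambda>\<omega>. B \<omega> x y) \<in> borel_measurable P"
proof -
  have "(\<lambda>(\<omega>, x, y). B \<omega> x y) \<in> borel_measurable (P \<Otimes>\<^sub>M count_space UNIV \<Otimes>\<^sub>M count_space UNIV)"
    using assms by (simp add: cocycles_def)
  then show ?thesis
    using measurable_compose[of "\<lambda>\<omega>. (\<omega>, x, y)" P "P \<Otimes>\<^sub>M count_space UNIV \<Otimes>\<^sub>M count_space UNIV"
        "\<lambda>(\<omega>, x, y). B \<omega> x y" borel] by simp
qed

lemma cocycle_stationary:
  assumes "B \<in> cocycles P"
  shows "AE \<omega> in P. B \<omega> (z + x) (z + y) = B (translate z \<omega>) x y"
  using assms unfolding cocycles_def by blast

lemma has_integral_cocycle_shift:
  assumes B: "B \<in> cocycles P" and "has_bochner_integral P (\<lambda>\<omega>. B \<omega> x y) a"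
  shows "has_bochner_integral P (\<lambda>\<omega>. B \<omega> (z + x) (z + y)) a"
proof -
  have "has_bochner_integral P (\<lambda>\<omega>. B (translate z \<omega>) x y) a"
    using has_integral_translate[OF assms(2)] .
  then show ?thesis
    using cocycle_stationary[OF B, of z x y] measurable_cocycle[OF B]
    by (subst has_bochner_integral_cong_AE[of _ _ "\<lambda>\<omega>. B (translate z \<omega>) x y"])
      (auto simp: has_bochner_integral_iff)
qed

lemma has_integral_cocycle_unit_step:
  assumes B: "B \<in> cocycles P" and e: "e \<in> {e1, e2}"
  shows "has_bochner_integral P (\<lambda>\<omega>. B \<omega> x (x + e)) (- (hvec P B \<bullet> rvec e))"
proof -
  have "has_bochner_integral P (\<lambda>\<omega>. B \<omega> 0 e) (- (hvec P B \<bullet> rvec e))"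
    using assms by (auto simp: cocycles_def has_bochner_integral_iff hvec_def inner_rvec_e)
  then show ?thesis
    using has_integral_cocycle_shift[OF B, of 0 e _ x] by simp
qed

lemma has_integral_cocycle_trans:
  assumes B: "B \<in> cocycles P"
    and "has_bochner_integral P (\<lambda>\<omega>. B \<omega> x y) a" "has_bochner_integral P (\<lambda>\<omega>. B \<omega> y z) b"
  shows "has_bochner_integral P (\<lambda>\<omega>. B \<omega> x z) (a + b)"
  using has_bochner_integral_add[OF assms(2,3)]
proof (rule has_bochner_integral_cong_AE[THEN iffD1, rotated 3])
  show "AE \<omega> in P. B \<omega> x y + B \<omega> y z = B \<omega> x z"
    using B unfolding cocycles_def by blast
qed (use measurable_cocycle[OF B] in auto)

text \<open>An up-right path from \<open>x\<close> to \<open>y\<close> splits the increment into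
  unit steps, whose means are given by \<open>hvec\<close>; hence the mean is linear in
  \<open>y - x\<close>.\<close>

lemma has_integral_cocycle_le:
  assumes B: "B \<in> cocycles P" and "x \<le> y"
  shows "has_bochner_integral P (\<lambda>\<omega>. B \<omega> x y) (- (hvec P B \<bullet> rvec (y - x)))"
proof -
  obtain p n where p: "up_right n p" "p 0 = x" "p n = y"
    using up_right_exists[OF assms(2)] by blast
  have "has_bochner_integral P (\<lambda>\<omega>. B \<omega> (p 0) (p n)) (- (hvec P B \<bullet> rvec (p n - p 0)))"
    using p(1)
  proof (induction n)
    case 0
    have "AE \<omega> in P. B \<omega> (p 0) (p 0) = 0"
      using cocycle_additive[OF B] by eventually_elim (metis add_cancel_right_right)
    then show ?case
      using measurable_cocycle[OF B]
      by (subst has_bochner_integral_cong_AE[of _ _ "\<lambda>_. 0"]) (auto simp: has_bochner_integral_zero)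
  next
    case (Suc n)
    have e: "p (Suc n) - p n \<in> {e1, e2}" and "up_right n p"
      using Suc.prems unfolding up_right_def by (blast, simp)
    have "has_bochner_integral P (\<lambda>\<omega>. B \<omega> (p n) (p (Suc n)))
        (- (hvec P B \<bullet> rvec (p (Suc n) - p n)))"
      using has_integral_cocycle_unit_step[OF B e, of "p n"] by simp
    from has_integral_cocycle_trans[OF B Suc.IH[OF \<open>up_right n p\<close>] this]
    show ?case
      by (simp add: rvec_diff inner_diff_right)
  qed
  then show ?thesis
    using p by simp
qed

text \<open>For sites that need not be ordered, compare both with their supremum \<open>z\<close>
  and subtract.\<close>

lemma has_integral_cocycle:
  assumes B: "B \<in> cocycles P"
  shows "has_bochner_integral P (\<lambda>\<omega>. B \<omega> x y) (- (hvec P B \<bullet> rvec (y - x)))"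
proof -
  define z where "z = sup x y"
  have z: "x \<le> z" "y \<le> z"
    by (simp_all add: z_def)
  from has_bochner_integral_diff[OF has_integral_cocycle_le[OF B z(1)] has_integral_cocycle_le[OF B z(2)]]
  have "has_bochner_integral P (\<lambda>\<omega>. B \<omega> x z - B \<omega> y z) (- (hvec P B \<bullet> rvec (y - x)))"
    by (simp add: rvec_diff inner_diff_right)
  then show ?thesis
  proof (rule has_bochner_integral_cong_AE[THEN iffD1, rotated 3])
    show "AE \<omega> in P. B \<omega> x z - B \<omega> y z = B \<omega> x y"
      using cocycle_additive[OF B]
    proof eventually_elim
      case (elim \<omega>)
      then have "B \<omega> x y + B \<omega> y z = B \<omega> x z"
        by blast
      then show ?case
        by simp
    qed
  qed (use measurable_cocycle[OF B] in auto)
qed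

text \<open>The reflection is an involution with two uses: with \<open>h = hvec P B\<close> it turns
  the Busemann cocycle into the centered \<open>F\<close>, and applied to a centered cocycle it
  produces a cocycle with vector \<open>h\<close>.\<close>

lemma reflected_cocycle:
  fixes h :: "real \<times> real"
  assumes B: "B \<in> cocycles P"
  defines "F \<equiv> \<lambda>\<omega> x y. h \<bullet> rvec (x - y) - B \<omega> x y"
  shows "F \<in> cocycles P" "hvec P F = h - hvec P B"
proof -
  have int: "integrable P (\<lambda>\<omega>. B \<omega> x y)" for x y
    using has_integral_cocycle[OF B] by (auto simp: has_bochner_integral_iff)
  have "(\<lambda>(\<omega>, x, y). B \<omega> x y) \<in> borel_measurable (P \<Otimes>\<^sub>M count_space UNIV \<Otimes>\<^sub>M count_space UNIV)"
    using B by (simp add: cocycles_def)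
  moreover have "(\<lambda>w. case snd w of (x, y) \<Rightarrow> h \<bullet> rvec (x - y))
      \<in> borel_measurable (P \<Otimes>\<^sub>M count_space UNIV \<Otimes>\<^sub>M count_space UNIV)"
    by (rule measurable_compose[OF measurable_snd]) (simp add: pair_measure_countable)
  ultimately have "(\<lambda>w. (case snd w of (x, y) \<Rightarrow> h \<bullet> rvec (x - y)) - (case w of (\<omega>, x, y) \<Rightarrow> B \<omega> x y))
      \<in> borel_measurable (P \<Otimes>\<^sub>M count_space UNIV \<Otimes>\<^sub>M count_space UNIV)"
    by (rule borel_measurable_diff[rotated])
  then have "(\<lambda>(\<omega>, x, y). F \<omega> x y) \<in> borel_measurable (P \<Otimes>\<^sub>M count_space UNIV \<Otimes>\<^sub>M count_space UNIV)"
    by (simp add: F_def split_beta')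
  moreover have "AE \<omega> in P. F \<omega> (z + x) (z + y) = F (translate z \<omega>) x y" for x y z
    using cocycle_stationary[OF B, of z x y] by eventually_elim (simp add: F_def)
  moreover have "AE \<omega> in P. F \<omega> x y + F \<omega> y z = F \<omega> x z" for x y z
    using cocycle_additive[OF B]
  proof eventually_elim
    case (elim \<omega>)
    then have "B \<omega> x y + B \<omega> y z = B \<omega> x z"
      by blast
    then show ?case
      by (simp add: F_def rvec_diff inner_diff_right)
  qed
  moreover have "integrable P (\<lambda>\<omega>. F \<omega> 0 e)" for e
    unfolding F_def using int by simp
  ultimately show "F \<in> cocycles P"
    unfolding cocycles_def by blast
  show "hvec P F = h - hvec P B"
    using int by (simp add: hvec_def F_def rvec_diff inner_rvec_e prob_space prod_eq_iff)
qed

text \<open>All means of a cocycle are determined by \<open>hvec\<close>, so centering has to be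
  checked only on the two unit steps.\<close>

lemma centered_cocycle_iff: "F \<in> centered_cocycles P \<longleftrightarrow> F \<in> cocycles P \<and> hvec P F = 0"
proof
  assume F: "F \<in> centered_cocycles P"
  then have "has_bochner_integral P (\<lambda>\<omega>. F \<omega> 0 e) 0" for e
    unfolding centered_cocycles_def by blast
  then have "(\<integral>\<omega>. F \<omega> 0 e \<partial>P) = 0" for e
    by (rule has_bochner_integral_integral_eq)
  then show "F \<in> cocycles P \<and> hvec P F = 0"
    using F by (simp add: centered_cocycles_def hvec_def zero_prod_def)
next
  assume F: "F \<in> cocycles P \<and> hvec P F = 0"
  then show "F \<in> centered_cocycles P"
    using has_integral_cocycle[of F] by (simp add: centered_cocycles_def)
qed

end

subsection \<open>Expected passage times and the point-to-point constant\<close>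

text \<open>Routing the path through \<open>e\<close> collects the weight at the origin. This is the
  lower bound that Fatou's lemma needs for Busemann increments.\<close>

lemma lpp_diff_ge:
  assumes "e \<in> {e1, e2}" "e \<le> y" "\<And>z. - c \<le> \<omega> z"
  shows "- c \<le> lpp \<omega> 0 y - lpp \<omega> e y"
  using lpp_first_step_ge[OF assms(1), of 0 y \<omega>] assms(2) assms(3)[of 0] by simp

lemma floor_vec_nonneg: "0 \<le> fst \<zeta> \<Longrightarrow> 0 \<le> snd \<zeta> \<Longrightarrow> 0 \<le> floor_vec (real n *\<^sub>R \<zeta>)"
  by (simp add: floor_vec_def less_eq_prod_def)

lemma tendsto_rvec_floor_vec:
  "(\<lambda>n. rvec (floor_vec (real n *\<^sub>R \<zeta>)) /\<^sub>R real n) \<longlonglongrightarrow> \<zeta>"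
  using tendsto_Pair[OF tendsto_floor_div[of "fst \<zeta>"] tendsto_floor_div[of "snd \<zeta>"]]
  by (simp add: rvec_def floor_vec_def divide_inverse mult.commute)

lemma l1norm_nonneg_eq: "0 \<le> x \<Longrightarrow> l1norm x = fst x + snd x"
  by (auto simp: l1norm_def less_eq_prod_def)

lemma is_gppD:
  assumes "is_gpp P g" "0 \<le> fst \<zeta>" "0 \<le> snd \<zeta>"
  shows "AE \<omega> in P. (\<lambda>n. lpp \<omega> 0 (floor_vec (real n *\<^sub>R \<zeta>)) / real n) \<longlonglongrightarrow> g \<zeta>"
  using assms unfolding is_gpp_def by blast

context stationary_weights
begin

text \<open>Stationarity moves the bound from the origin to each site, and countably many null sets
  are discarded.\<close>

lemma cocycle_dominates_everywhere:
  assumes B: "B \<in> cocycles P"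
    and dom: "AE \<omega> in P. \<forall>e\<in>{e1, e2}. \<omega> 0 \<le> r + B \<omega> 0 e"
  shows "AE \<omega> in P. \<forall>z. \<forall>e\<in>{e1, e2}. \<omega> z \<le> r + B \<omega> z (z + e)"
  unfolding AE_all_countable
proof
  fix z
  show "AE \<omega> in P. \<forall>e\<in>{e1, e2}. \<omega> z \<le> r + B \<omega> z (z + e)"
    using AE_translate[OF dom, of z] cocycle_stationary[OF B, of z 0 e1]
      cocycle_stationary[OF B, of z 0 e2]
    by eventually_elim (simp add: translate_def)
qed

lemma expectation_lpp_le:
  assumes B: "B \<in> cocycles P"
    and dom: "AE \<omega> in P. \<forall>e\<in>{e1, e2}. \<omega> 0 \<le> r + B \<omega> 0 e"
    and x: "0 \<le> x"
  shows "expectation (\<lambda>\<omega>. lpp \<omega> 0 x) \<le> r * real_of_int (l1norm x) - hvec P B \<bullet> rvec x"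
proof -
  have "AE \<omega> in P. lpp \<omega> 0 x \<le> r * real_of_int (l1norm x) + B \<omega> 0 x"
    using cocycle_dominates_everywhere[OF B dom] cocycle_additive[OF B]
  proof eventually_elim
    case (elim \<omega>)
    \<comment> \<open>The potential gains \<open>r\<close> at every step in addition to the cocycle
      increment. The coordinate sum replaces \<open>l1norm\<close> because the gain must be exactly
      one at all sites, also outside the quadrant.\<close>
    define b where "b z = r * real_of_int (fst z + snd z) + B \<omega> 0 z" for z
    have "\<omega> z \<le> b (z + e) - b z" if e: "e \<in> {e1, e2}" for z e
    proof -
      have "B \<omega> 0 z + B \<omega> z (z + e) = B \<omega> 0 (z + e)"
        using elim(2) by blast
      moreover have "\<omega> z \<le> r + B \<omega> z (z + e)"
        using elim(1) e by blast
      moreover have "fst e + snd e = 1"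
        using e by (auto simp: e1_def e2_def)
      then have "real_of_int (fst (z + e) + snd (z + e)) = real_of_int (fst z + snd z) + 1"
        by simp
      ultimately show ?thesis
        by (simp only: b_def) (simp add: algebra_simps)
    qed
    then have "lpp \<omega> 0 x \<le> b x - b 0"
      by (rule lpp_le_potential[OF x])
    moreover have "B \<omega> 0 0 = 0"
      using elim(2) by (metis add_cancel_right_right)
    ultimately show ?case
      by (simp add: b_def l1norm_nonneg_eq[OF x])
  qed
  moreover have B0x: "has_bochner_integral P (\<lambda>\<omega>. B \<omega> 0 x) (- (hvec P B \<bullet> rvec x))"
    using has_integral_cocycle[OF B, of 0 x] by simp
  ultimately have "expectation (\<lambda>\<omega>. lpp \<omega> 0 x)
      \<le> expectation (\<lambda>\<omega>. r * real_of_int (l1norm x) + B \<omega> 0 x)"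
    using integrable_lpp[OF x]
    by (intro integral_mono_AE) (auto simp: has_bochner_integral_iff)
  also have "\<dots> = r * real_of_int (l1norm x) - hvec P B \<bullet> rvec x"
    using B0x by (simp add: has_bochner_integral_iff prob_space)
  finally show ?thesis .
qed

text \<open>The bounds on expected passage times to the rounded endpoints, divided by
  \<open>n\<close>, converge to the right-hand side, while Fatou's lemma provides minorants of these
  means that converge to \<open>g \<zeta>\<close>.\<close>

lemma gpp_le_cocycle:
  assumes B: "B \<in> cocycles P"
    and dom: "AE \<omega> in P. \<forall>e\<in>{e1, e2}. \<omega> 0 \<le> r + B \<omega> 0 e"
    and g: "is_gpp P g" and \<zeta>: "0 \<le> fst \<zeta>" "0 \<le> snd \<zeta>"
  shows "g \<zeta> \<le> r * (fst \<zeta> + snd \<zeta>) - hvec P B \<bullet> \<zeta>"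
proof -
  define v where "v n = floor_vec (real n *\<^sub>R \<zeta>)" for n
  have v: "0 \<le> v n" for n
    unfolding v_def using \<zeta> by (rule floor_vec_nonneg)
  have v_le: "real_of_int (l1norm (v n)) \<le> real n * (fst \<zeta> + snd \<zeta>)" for n
    using l1norm_nonneg_eq[OF v[of n]] by (simp add: v_def floor_vec_def algebra_simps add_mono)
  define X where "X n \<omega> = lpp \<omega> 0 (v n) / real n" for n \<omega>
  have X: "integrable P (X n)" for n
    using integrable_lpp[OF v] by (simp add: X_def[abs_def])
  have lower: "AE \<omega> in P. - (c * (fst \<zeta> + snd \<zeta>)) \<le> X n \<omega>" for n
    using weight_ge
  proof eventually_elim
    case (elim \<omega>)
    show ?case
    \<comment> \<open>At \<open>n = 0\<close> the quotient is zero by the convention for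
      division.\<close>
    proof (cases "n = 0")
      case True
      then show ?thesis
        using c_nonneg \<zeta> by (simp add: X_def)
    next
      case False
      have "c * real_of_int (l1norm (v n)) \<le> c * (real n * (fst \<zeta> + snd \<zeta>))"
        using v_le c_nonneg by (rule mult_left_mono)
      moreover have "- c * real_of_int (l1norm (v n)) \<le> lpp \<omega> 0 (v n)"
        using lpp_ge_const[OF v[of n], of c \<omega>] elim by simp
      ultimately have "- (c * (real n * (fst \<zeta> + snd \<zeta>))) \<le> lpp \<omega> 0 (v n)"
        by linarith
      then show ?thesis
        using False by (simp add: X_def field_simps)
    qed
  qed
  have lim: "AE \<omega> in P. (\<lambda>n. X n \<omega>) \<longlonglongrightarrow> g \<zeta>"
    unfolding X_def v_def by (rule is_gppD[OF g \<zeta>])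
  obtain b where b: "b \<longlonglongrightarrow> expectation (\<lambda>_. g \<zeta>)" "\<And>n. b n \<le> expectation (X n)"
    using fatou_lower_bound[OF X integrable_const lower lim] by blast
  have "g \<zeta> \<le> r * (fst \<zeta> + snd \<zeta>) - hvec P B \<bullet> \<zeta>"
  proof (rule LIMSEQ_le)
    show "b \<longlonglongrightarrow> g \<zeta>"
      using b(1) by (simp add: prob_space)
    let ?w = "\<lambda>n. rvec (v n) /\<^sub>R real n"
    show "(\<lambda>n. r * (fst (?w n) + snd (?w n)) - hvec P B \<bullet> ?w n)
        \<longlonglongrightarrow> r * (fst \<zeta> + snd \<zeta>) - hvec P B \<bullet> \<zeta>"
      unfolding v_def by (intro tendsto_intros tendsto_rvec_floor_vec)
    show "\<exists>N. \<forall>n\<ge>N. b n \<le> r * (fst (?w n) + snd (?w n)) - hvec P B \<bullet> ?w n"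
    proof (intro exI allI impI)
      fix n :: nat assume "1 \<le> n"
      have "b n \<le> expectation (\<lambda>\<omega>. lpp \<omega> 0 (v n)) / real n"
        using b(2)[of n] by (simp add: X_def[abs_def])
      also have "\<dots> \<le> (r * real_of_int (l1norm (v n)) - hvec P B \<bullet> rvec (v n)) / real n"
        using expectation_lpp_le[OF B dom v[of n]] by (intro divide_right_mono) auto
      also have "\<dots> = r * (fst (?w n) + snd (?w n)) - hvec P B \<bullet> ?w n"
        using \<open>1 \<le> n\<close> by (simp add: l1norm_nonneg_eq[OF v] rvec_def inner_prod_def field_simps)
      finally show "b n \<le> r * (fst (?w n) + snd (?w n)) - hvec P B \<bullet> ?w n" .
    qed
  qed
  then show ?thesis .
qed

text \<open>Truncating at \<open>M\<close> replaces Kingman's theorem: the averages of the truncated block passage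
  times are bounded and dominated by the truncated passage time along \<open>w\<close>, so bounded
  convergence suffices.\<close>

lemma expectation_lpp_le_limit:
  assumes u: "0 \<le> u"
    and w: "\<And>n. (int n * fst u, int n * snd u) \<le> w n"
      "\<And>n. l1norm (w n - (int n * fst u, int n * snd u)) \<le> int n * int K"
    and lim: "AE \<omega> in P. (\<lambda>n. lpp \<omega> 0 (w n) / real n) \<longlonglongrightarrow> \<gamma>"
  shows "expectation (\<lambda>\<omega>. lpp \<omega> 0 u) \<le> \<gamma> + c * real K"
proof -
  define m where "m n = (int n * fst u, int n * snd u)" for n :: nat
  have m_nonneg: "0 \<le> m n" for n
    using u by (simp add: m_def less_eq_prod_def)
  have m_Suc: "m (Suc n) = m n + u" for n
    by (simp add: m_def algebra_simps prod_eq_iff)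
  have w_nonneg: "0 \<le> w n" for n
    using m_nonneg[of n] w(1)[of n] by (simp add: m_def)
  define X where "X n \<omega> = lpp \<omega> (m n) (m (Suc n))" for n \<omega>
  have X: "integrable P (X n)" for n
    unfolding X_def m_Suc using u by (intro integrable_lpp) (simp add: less_eq_prod_def)
  have sum_X_le: "(\<Sum>k<n. X k \<omega>) \<le> lpp \<omega> 0 (m n)" for n \<omega>
  proof (induction n)
    case 0
    show ?case
      by (simp add: m_def zero_prod_def[symmetric])
  next
    case (Suc n)
    have "m n \<le> m (Suc n)"
      unfolding m_Suc using u by (simp add: less_eq_prod_def)
    then show ?case
      using lpp_superadditive[OF m_nonneg, of n "m (Suc n)" \<omega>] Suc.IH by (simp add: X_def)
  qed
  \<comment> \<open>Every block is a translate of the passage time to \<open>u\<close>, so the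
    truncated blocks all have the same mean.\<close>
  have E_min: "expectation (\<lambda>\<omega>. min (X n \<omega>) M) = expectation (\<lambda>\<omega>. min (lpp \<omega> 0 u) M)" for n M
    using has_integral_translate[of "\<lambda>\<omega>. min (lpp \<omega> 0 u) M" _ "m n"] integrable_lpp[OF u]
    by (auto simp: has_bochner_integral_iff lpp_translate X_def m_Suc)
  have truncated: "expectation (\<lambda>\<omega>. min (lpp \<omega> 0 u) M) \<le> \<gamma> + c * real K" if "0 \<le> M" for M
  proof -
    \<comment> \<open>The points \<open>m n\<close> and \<open>w n\<close> are at distance at most
      \<open>n * K\<close>, so passing from one endpoint to the other costs at most
      \<open>c * real K\<close> after division by \<open>n\<close>.\<close>
    define Z where "Z n \<omega> = min M (lpp \<omega> 0 (w n) / real n + c * real K)" for n \<omega>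
    have Z: "integrable P (Z n)" for n
      unfolding Z_def using integrable_lpp[OF w_nonneg] by simp
    have Z_ge: "AE \<omega> in P. - (c * real_of_int (l1norm u)) \<le> Z n \<omega>" for n
      using weight_ge
    proof eventually_elim
      case (elim \<omega>)
      have l1u: "0 \<le> c * real_of_int (l1norm u)" "0 \<le> c * real K"
        using c_nonneg by (auto simp: l1norm_def)
      have "- (c * real_of_int (l1norm u)) \<le> lpp \<omega> 0 (w n) / real n + c * real K"
      proof (cases "n = 0")
        case False
        have "l1norm (w n) \<le> int n * l1norm u + int n * int K"
          using w(1)[of n] w(2)[of n]
          by (simp add: l1norm_nonneg_eq[OF u] l1norm_nonneg_eq[OF w_nonneg])
            (simp add: l1norm_def less_eq_prod_def algebra_simps)
        then have "real_of_int (l1norm (w n)) \<le> real_of_int (int n * l1norm u + int n * int K)"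
          by (simp only: of_int_le_iff)
        then have "c * real_of_int (l1norm (w n)) \<le> c * (real n * (real_of_int (l1norm u) + real K))"
          using c_nonneg by (intro mult_left_mono) (simp_all add: algebra_simps)
        moreover have "- c * real_of_int (l1norm (w n)) \<le> lpp \<omega> 0 (w n)"
          using lpp_ge_const[OF w_nonneg[of n], of c \<omega>] elim by simp
        ultimately have "- (c * (real n * (real_of_int (l1norm u) + real K))) \<le> lpp \<omega> 0 (w n)"
          by linarith
        then show ?thesis
          using False by (simp add: field_simps)
      qed (use l1u in simp)
      then show ?case
        using l1u \<open>0 \<le> M\<close> by (simp add: Z_def)
    qed
    have le: "expectation (\<lambda>\<omega>. min (lpp \<omega> 0 u) M) \<le> expectation (Z n)" if "0 < n" for n
    proof -
      have "real n * expectation (\<lambda>\<omega>. min (lpp \<omega> 0 u) M)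
          = (\<Sum>k<n. expectation (\<lambda>\<omega>. min (X k \<omega>) M))"
        by (simp add: E_min)
      also have "\<dots> = expectation (\<lambda>\<omega>. \<Sum>k<n. min (X k \<omega>) M)"
        using X by (intro Bochner_Integration.integral_sum[symmetric]) auto
      also have "\<dots> \<le> expectation (\<lambda>\<omega>. real n * Z n \<omega>)"
      proof (rule integral_mono_AE)
        show "AE \<omega> in P. (\<Sum>k<n. min (X k \<omega>) M) \<le> real n * Z n \<omega>"
          using weight_ge
        proof eventually_elim
          case (elim \<omega>)
          have "(\<Sum>k<n. min (X k \<omega>) M) \<le> (\<Sum>k<n. M)"
            by (intro sum_mono) simp
          then have 1: "(\<Sum>k<n. min (X k \<omega>) M) \<le> real n * M"
            by simp
          have "(\<Sum>k<n. min (X k \<omega>) M) \<le> (\<Sum>k<n. X k \<omega>)"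
            by (intro sum_mono) simp
          also have "\<dots> \<le> lpp \<omega> 0 (m n)"
            by (rule sum_X_le)
          also have "\<dots> \<le> lpp \<omega> 0 (w n) + c * real_of_int (l1norm (w n - m n))"
            using w(1)[of n] elim by (intro lpp_mono_endpoint m_nonneg) (auto simp: m_def)
          also have "\<dots> \<le> lpp \<omega> 0 (w n) + c * real_of_int (int n * int K)"
            using w(2)[of n] c_nonneg
            by (intro add_left_mono mult_left_mono) (simp_all only: of_int_le_iff m_def)
          also have "\<dots> = real n * (lpp \<omega> 0 (w n) / real n + c * real K)"
            using \<open>0 < n\<close> by (simp add: field_simps)
          finally have 2: "(\<Sum>k<n. min (X k \<omega>) M) \<le> real n * (lpp \<omega> 0 (w n) / real n + c * real K)" .
          show ?case
            using 1 2 by (simp add: Z_def min_def)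
        qed
      qed (use X Z in auto)
      also have "\<dots> = real n * expectation (Z n)"
        by simp
      finally show ?thesis
        using \<open>0 < n\<close> by simp
    qed
    \<comment> \<open>Almost surely \<open>Z n\<close> stays between two constants that do not
      depend on \<open>n\<close>, so its limit passes to the means.\<close>
    have "(\<lambda>n. expectation (Z n)) \<longlonglongrightarrow> expectation (\<lambda>_. min M (\<gamma> + c * real K))"
    proof (rule integral_dominated_convergence)
      show "AE \<omega> in P. (\<lambda>n. Z n \<omega>) \<longlonglongrightarrow> min M (\<gamma> + c * real K)"
        using lim unfolding Z_def by eventually_elim (intro tendsto_intros)
      show "AE \<omega> in P. norm (Z n \<omega>) \<le> M + c * real_of_int (l1norm u)" for n
        using Z_ge[of n]
      proof eventually_elim
        case (elim \<omega>)
        have "Z n \<omega> \<le> M" "0 \<le> c * real_of_int (l1norm u)"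
          using c_nonneg by (auto simp: Z_def l1norm_def)
        then show ?case
          using elim \<open>0 \<le> M\<close> by auto
      qed
    qed (use Z in auto)
    then have "(\<lambda>n. expectation (Z n)) \<longlonglongrightarrow> min M (\<gamma> + c * real K)"
      by (simp add: prob_space)
    then have "expectation (\<lambda>\<omega>. min (lpp \<omega> 0 u) M) \<le> min M (\<gamma> + c * real K)"
      using le by (intro LIMSEQ_le_const) (auto intro!: exI[of _ 1])
    then show ?thesis
      by simp
  qed
  \<comment> \<open>The truncation is removed by letting its level tend to infinity, with
    \<open>\<bar>lpp \<omega> 0 u\<bar>\<close> as majorant.\<close>
  have "(\<lambda>k. expectation (\<lambda>\<omega>. min (lpp \<omega> 0 u) (real k))) \<longlonglongrightarrow> expectation (\<lambda>\<omega>. lpp \<omega> 0 u)"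
  proof (rule integral_dominated_convergence)
    show "AE \<omega> in P. (\<lambda>k. min (lpp \<omega> 0 u) (real k)) \<longlonglongrightarrow> lpp \<omega> 0 u"
    proof (rule AE_I2)
      fix \<omega>
      have "\<forall>\<^sub>F k in sequentially. min (lpp \<omega> 0 u) (real k) = lpp \<omega> 0 u"
        using eventually_ge_at_top[of "nat \<lceil>lpp \<omega> 0 u\<rceil>"] by eventually_elim linarith
      then show "(\<lambda>k. min (lpp \<omega> 0 u) (real k)) \<longlonglongrightarrow> lpp \<omega> 0 u"
        by (rule tendsto_eventually)
    qed
    show "integrable P (\<lambda>\<omega>. \<bar>lpp \<omega> 0 u\<bar>)"
      using integrable_lpp[OF u] by simp
  qed (use integrable_lpp[OF u] in auto)
  then show ?thesis
    using truncated by (intro LIMSEQ_le_const2) auto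
qed

end

subsection \<open>Busemann increments along a direction\<close>

text \<open>Only the first coordinate is rounded and the second is its complement. Thus the sequence
  is itself an up-right path with \<open>l1norm\<close> exactly \<open>n\<close>, which rounding
  both coordinates as in \<open>floor_vec\<close> would not guarantee.\<close>

definition direction_path :: "real \<Rightarrow> nat \<Rightarrow> site"
  where "direction_path a n = (\<lfloor>real n * a\<rfloor>, int n - \<lfloor>real n * a\<rfloor>)"

lemma direction_path_nonneg:
  assumes "0 < a" "a < 1"
  shows "0 \<le> direction_path a n"
proof -
  have "real n * a \<le> real n"
    using assms by (simp add: mult_left_le)
  then have "\<lfloor>real n * a\<rfloor> \<le> int n"
    by linarith
  then show ?thesis
    using assms by (simp add: direction_path_def less_eq_prod_def)
qed

lemma l1norm_direction_path:
  assumes "0 < a" "a < 1"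
  shows "l1norm (direction_path a n) = int n"
  using l1norm_nonneg_eq[OF direction_path_nonneg[OF assms]] by (simp add: direction_path_def)

lemma direction_path_step:
  assumes "0 < a" "a < 1"
  shows "direction_path a (Suc n) - direction_path a n \<in> {e1, e2}"
proof -
  have "real (Suc n) * a = real n * a + a"
    by (simp add: algebra_simps)
  then have "\<lfloor>real (Suc n) * a\<rfloor> = \<lfloor>real n * a\<rfloor> \<or> \<lfloor>real (Suc n) * a\<rfloor> = \<lfloor>real n * a\<rfloor> + 1"
    using assms by linarith
  then show ?thesis
    by (auto simp: direction_path_def e1_def e2_def)
qed

lemma tendsto_fst_direction_path: "(\<lambda>n. real_of_int (fst (direction_path a n)) / real n) \<longlonglongrightarrow> a"
  using tendsto_floor_div[of a] by (simp add: direction_path_def)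

lemma tendsto_rvec_direction_path:
  "(\<lambda>n. rvec (direction_path a n) /\<^sub>R real n) \<longlonglongrightarrow> (a, 1 - a)"
proof (rule Lim_transform_eventually)
  let ?f = "\<lambda>n. real_of_int \<lfloor>real n * a\<rfloor> / real n"
  show "(\<lambda>n. (?f n, 1 - ?f n)) \<longlonglongrightarrow> (a, 1 - a)"
    by (intro tendsto_intros tendsto_floor_div)
  show "\<forall>\<^sub>F n in sequentially. (?f n, 1 - ?f n) = rvec (direction_path a n) /\<^sub>R real n"
    using eventually_gt_at_top[of 0]
    by eventually_elim (simp add: direction_path_def rvec_def field_simps)
qed

text \<open>Passage times from \<open>e1\<close> and \<open>e2\<close> to the endpoint are
  meaningful only from such an \<open>n\<close> on.\<close>

lemma eventually_unit_le_direction_path: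
  assumes a: "0 < a" "a < 1"
  shows "\<forall>\<^sub>F n in sequentially. e1 \<le> direction_path a n \<and> e2 \<le> direction_path a n"
proof -
  have "filterlim (\<lambda>n. real n * a) at_top sequentially"
    "filterlim (\<lambda>n. real n * (1 - a)) at_top sequentially"
    using a by (auto intro!: filterlim_at_top_mult_tendsto_pos[OF tendsto_const] filterlim_real_sequentially)
  then have "\<forall>\<^sub>F n in sequentially. 1 \<le> real n * a" "\<forall>\<^sub>F n in sequentially. 1 \<le> real n * (1 - a)"
    by (simp_all add: filterlim_at_top)
  then show ?thesis
  proof eventually_elim
    case (elim n)
    have "real n * a + real n * (1 - a) = real n"
      by (simp add: algebra_simps)
    then have "1 \<le> \<lfloor>real n * a\<rfloor>" "\<lfloor>real n * a\<rfloor> + 1 \<le> int n"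
      using elim by linarith+
    then show ?case
      by (simp add: direction_path_def e1_def e2_def less_eq_prod_def)
  qed
qed

context stationary_weights
begin

text \<open>By stationarity the mean passage time from \<open>e\<close> to \<open>u n\<close> equals
  that from the origin to \<open>u n - e\<close>. The mean of the difference is therefore an
  increment of the expected passage time in its endpoint, and Fatou's lemma compares it with the
  mean of \<open>B \<omega> 0 e\<close>.\<close>

lemma busemann_increment:
  assumes B: "B \<in> cocycles P" and e: "e \<in> {e1, e2}" and u: "\<And>n. e \<le> u n"
    and lim: "AE \<omega> in P. (\<lambda>n. lpp \<omega> 0 (u n) - lpp \<omega> e (u n)) \<longlonglongrightarrow> B \<omega> 0 e"
  obtains b where "b \<longlonglongrightarrow> - (hvec P B \<bullet> rvec e)"
    "\<And>n. b n \<le> expectation (\<lambda>\<omega>. lpp \<omega> 0 (u n)) - expectation (\<lambda>\<omega>. lpp \<omega> 0 (u n - e))"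
proof -
  define X where "X n \<omega> = lpp \<omega> 0 (u n) - lpp \<omega> e (u n)" for n \<omega>
  have u0: "0 \<le> u n" "0 \<le> u n - e" for n
    using u[of n] e_nonneg[OF e] by (auto simp: less_eq_prod_def)
  have X: "integrable P (X n)" for n
    unfolding X_def[abs_def] using integrable_lpp u0 u by simp
  have B0e: "has_bochner_integral P (\<lambda>\<omega>. B \<omega> 0 e) (- (hvec P B \<bullet> rvec e))"
    using has_integral_cocycle[OF B, of 0 e] by simp
  have lower: "AE \<omega> in P. - c \<le> X n \<omega>" for n
    using weight_ge
  proof eventually_elim
    case (elim \<omega>)
    then show ?case
      unfolding X_def by (intro lpp_diff_ge[OF e u]) blast
  qed
  have "AE \<omega> in P. (\<lambda>n. X n \<omega>) \<longlonglongrightarrow> B \<omega> 0 e"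
    using lim by (simp add: X_def)
  from fatou_lower_bound[OF X _ lower this] B0e
  obtain b where b: "b \<longlonglongrightarrow> - (hvec P B \<bullet> rvec e)" "\<And>n. b n \<le> expectation (X n)"
    by (auto simp: has_bochner_integral_iff)
  moreover have "expectation (X n)
      = expectation (\<lambda>\<omega>. lpp \<omega> 0 (u n)) - expectation (\<lambda>\<omega>. lpp \<omega> 0 (u n - e))" for n
    using expectation_lpp_shift[OF u0(2)[of n], of e] integrable_lpp[OF u0(1)] integrable_lpp[OF u]
    by (simp add: X_def[abs_def])
  ultimately show thesis
    using that by simp
qed

text \<open>Summing the asymptotic increments along \<open>direction_path a\<close> bounds the
  expected passage time from below by nearly the mean of the cocycle. Superadditivity bounds it from
  above by \<open>g\<close> up to a constant, and division by \<open>n\<close> removes the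
  constants.\<close>

lemma cocycle_le_gpp:
  assumes B: "B \<in> cocycles P" and g: "is_gpp P g" and a: "0 < a" "a < 1"
    and lim: "\<And>e. e \<in> {e1, e2} \<Longrightarrow> AE \<omega> in P.
      (\<lambda>n. lpp \<omega> 0 (direction_path a n) - lpp \<omega> e (direction_path a n)) \<longlonglongrightarrow> B \<omega> 0 e"
  shows "- (hvec P B \<bullet> (a, 1 - a)) \<le> g (a, 1 - a)"
proof -
  define u where "u = direction_path a"
  define h where "h = hvec P B"
  define d where "d x = expectation (\<lambda>\<omega>. lpp \<omega> 0 x)" for x
  have u0: "0 \<le> u n" for n
    unfolding u_def using direction_path_nonneg[OF a] .
  \<comment> \<open>\<open>busemann_increment\<close> wants \<open>e\<close> below every endpoint,
    so it is applied to the sequence started at \<open>N0\<close>.\<close>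
  obtain N0 where N0: "\<And>n. N0 \<le> n \<Longrightarrow> e1 \<le> u n \<and> e2 \<le> u n"
    using eventually_unit_le_direction_path[OF a] unfolding u_def eventually_sequentially by blast
  have step: "\<forall>\<^sub>F n in sequentially. - (h \<bullet> rvec e) - \<epsilon> \<le> d (u n) - d (u n - e)"
    if e: "e \<in> {e1, e2}" and "0 < \<epsilon>" for e \<epsilon>
  proof -
    have "AE \<omega> in P. (\<lambda>n. lpp \<omega> 0 (u (n + N0)) - lpp \<omega> e (u (n + N0))) \<longlonglongrightarrow> B \<omega> 0 e"
      using lim[OF e] unfolding u_def by eventually_elim (rule LIMSEQ_ignore_initial_segment)
    moreover have "e \<le> u (n + N0)" for n
      using N0[of "n + N0"] e by auto
    ultimately obtain b where b: "b \<longlonglongrightarrow> - (h \<bullet> rvec e)"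
      "\<And>n. b n \<le> d (u (n + N0)) - d (u (n + N0) - e)"
      using busemann_increment[OF B e, of "\<lambda>n. u (n + N0)"] unfolding h_def d_def by blast
    have "\<forall>\<^sub>F n in sequentially. - (h \<bullet> rvec e) - \<epsilon> < b n"
      using order_tendstoD(1)[OF b(1)] \<open>0 < \<epsilon>\<close> by simp
    then have "\<forall>\<^sub>F n in sequentially. - (h \<bullet> rvec e) - \<epsilon> \<le> d (u (n + N0)) - d (u (n + N0) - e)"
    proof eventually_elim
      case (elim n)
      then show ?case
        using b(2)[of n] by linarith
    qed
    then show ?thesis
      using eventually_sequentially_seg[of "\<lambda>n. - (h \<bullet> rvec e) - \<epsilon> \<le> d (u n) - d (u n - e)" N0] by simp
  qed
  \<comment> \<open>Going \<open>K\<close> further in direction \<open>(a, 1 - a)\<close> gains at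
    least one in each coordinate. This absorbs the rounding in \<open>u m\<close>, so that multiples
    of \<open>u m\<close> stay below the rounded multiples of the point
    \<open>real (m + K) *\<^sub>R (a, 1 - a)\<close> on the ray.\<close>
  obtain K where K: "1 \<le> real K * a" "1 \<le> real K * (1 - a)"
  proof -
    obtain K1 K2 :: nat where "1 / a \<le> real K1" "1 / (1 - a) \<le> real K2"
      by (meson real_arch_simple)
    then have "1 \<le> real K1 * a" "1 \<le> real K2 * (1 - a)"
      using a by (simp_all add: field_simps)
    moreover have "real K1 * a \<le> real (max K1 K2) * a" "real K2 * (1 - a) \<le> real (max K1 K2) * (1 - a)"
      using a by (auto intro!: mult_right_mono)
    ultimately show thesis
      using that[of "max K1 K2"] by linarith
  qed
  have upper: "d (u m) \<le> real (m + K) * g (a, 1 - a) + c * real K" if "0 < m" for m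
    unfolding d_def
  proof (rule expectation_lpp_le_limit[where w = "\<lambda>n. floor_vec (real (n * (m + K)) *\<^sub>R (a, 1 - a))"])
    fix n :: nat
    let ?w = "floor_vec (real (n * (m + K)) *\<^sub>R (a, 1 - a))"
    have "real_of_int \<lfloor>real m * a\<rfloor> \<le> real m * a" "real m * a - 1 \<le> real_of_int \<lfloor>real m * a\<rfloor>"
      by linarith+
    moreover have "real (m + K) * a = real m * a + real K * a"
      "real (m + K) * (1 - a) = real m - real m * a + real K * (1 - a)"
      by (simp_all add: algebra_simps)
    ultimately have "real_of_int \<lfloor>real m * a\<rfloor> \<le> real (m + K) * a"
      "real m - real_of_int \<lfloor>real m * a\<rfloor> \<le> real (m + K) * (1 - a)"
      using K by linarith+
    then have "real n * real_of_int \<lfloor>real m * a\<rfloor> \<le> real n * (real (m + K) * a)"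
      "real n * (real m - real_of_int \<lfloor>real m * a\<rfloor>) \<le> real n * (real (m + K) * (1 - a))"
      by (auto intro: mult_left_mono)
    then show le: "(int n * fst (u m), int n * snd (u m)) \<le> ?w"
      by (simp add: u_def direction_path_def floor_vec_def less_eq_prod_def le_floor_iff mult.assoc)
    have "real_of_int (fst ?w) + real_of_int (snd ?w) \<le> real (n * (m + K)) * a + real (n * (m + K)) * (1 - a)"
      unfolding floor_vec_def by (intro add_mono) simp_all
    also have "\<dots> = real_of_int (int n * int m + int n * int K)"
      by (simp add: algebra_simps)
    finally have "fst ?w + snd ?w \<le> int n * int m + int n * int K"
      by linarith
    moreover have "int n * fst (u m) + int n * snd (u m) = int n * int m"
      by (simp add: u_def direction_path_def algebra_simps)
    ultimately show "l1norm (?w - (int n * fst (u m), int n * snd (u m))) \<le> int n * int K"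
      using le by (simp add: l1norm_def less_eq_prod_def)
  next
    have "AE \<omega> in P. (\<lambda>N. lpp \<omega> 0 (floor_vec (real N *\<^sub>R (a, 1 - a))) / real N) \<longlonglongrightarrow> g (a, 1 - a)"
      using a by (intro is_gppD[OF g]) simp_all
    then show "AE \<omega> in P. (\<lambda>n. lpp \<omega> 0 (floor_vec (real (n * (m + K)) *\<^sub>R (a, 1 - a))) / real n)
        \<longlonglongrightarrow> real (m + K) * g (a, 1 - a)"
    proof eventually_elim
      case (elim \<omega>)
      \<comment> \<open>The endpoints stay on the ray through \<open>(a, 1 - a)\<close>, so the
        limit is read off along the multiples of \<open>m + K\<close>; the factor
        \<open>real (m + K)\<close> appears without appeal to homogeneity of
        \<open>g\<close>.\<close>
      have sub: "filterlim (\<lambda>n. n * (m + K)) sequentially sequentially"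
        using \<open>0 < m\<close> by (intro filterlim_subseq) (simp add: strict_mono_def)
      have "(\<lambda>n. real (m + K) * (lpp \<omega> 0 (floor_vec (real (n * (m + K)) *\<^sub>R (a, 1 - a))) / real (n * (m + K))))
          \<longlonglongrightarrow> real (m + K) * g (a, 1 - a)"
        by (rule tendsto_mult_left[OF filterlim_compose[OF elim sub]])
      moreover have "real (m + K) * (y / real (n * (m + K))) = y / real n" for y n
        using \<open>0 < m\<close> by simp
      ultimately show ?case
        by (simp only:)
    qed
  qed (rule u0)
  have "- (h \<bullet> (a, 1 - a)) - \<epsilon> \<le> g (a, 1 - a)" if pos: "0 < \<epsilon>" for \<epsilon>
  proof -
    obtain N where N: "\<And>n e. N \<le> n \<Longrightarrow> e \<in> {e1, e2} \<Longrightarrow> - (h \<bullet> rvec e) - \<epsilon> \<le> d (u n) - d (u n - e)"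
    proof -
      have "\<forall>\<^sub>F n in sequentially. \<forall>e\<in>{e1, e2}. - (h \<bullet> rvec e) - \<epsilon> \<le> d (u n) - d (u n - e)"
        using step[OF _ pos] by (intro eventually_ball_finite) auto
      then show thesis
        using that unfolding eventually_sequentially by blast
    qed
    \<comment> \<open>Chosen so that the bound below is an equality at \<open>n = N\<close>.\<close>
    define C where "C = d (u N) + h \<bullet> rvec (u N) + \<epsilon> * real N"
    have lower: "C - h \<bullet> rvec (u n) - \<epsilon> * real n \<le> d (u n)" if "N \<le> n" for n
      using that
    proof (induction n rule: dec_induct)
      case base
      show ?case
        by (simp add: C_def)
    next
      case (step n)
      define e where "e = u (Suc n) - u n"
      have e: "e \<in> {e1, e2}"
        unfolding e_def u_def by (rule direction_path_step[OF a])
      have "- (h \<bullet> rvec e) - \<epsilon> \<le> d (u (Suc n)) - d (u (Suc n) - e)"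
        using N[of "Suc n" e] e step.hyps by simp
      then have "- (h \<bullet> rvec (u (Suc n))) + h \<bullet> rvec (u n) - \<epsilon> \<le> d (u (Suc n)) - d (u n)"
        by (simp add: e_def rvec_diff inner_diff_right)
      then show ?case
        using step.IH by (simp add: algebra_simps)
    qed
    let ?g = "g (a, 1 - a)"
    let ?w = "\<lambda>n. rvec (u n) /\<^sub>R real n"
    have "(\<lambda>n. C * (1 / real n) - h \<bullet> ?w n - \<epsilon>) \<longlonglongrightarrow> C * 0 - h \<bullet> (a, 1 - a) - \<epsilon>"
      unfolding u_def by (intro tendsto_intros tendsto_rvec_direction_path lim_1_over_n)
    moreover have "(\<lambda>n. ?g + (real K * ?g + c * real K) * (1 / real n)) \<longlonglongrightarrow> ?g + (real K * ?g + c * real K) * 0"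
      by (intro tendsto_intros lim_1_over_n)
    moreover have "C * (1 / real n) - h \<bullet> ?w n - \<epsilon> \<le> ?g + (real K * ?g + c * real K) * (1 / real n)"
      if "max 1 N \<le> n" for n
    proof -
      have "C - h \<bullet> rvec (u n) - \<epsilon> * real n \<le> real (n + K) * ?g + c * real K"
        using lower[of n] upper[of n] that by simp
      then have "(C - h \<bullet> rvec (u n) - \<epsilon> * real n) / real n \<le> (real (n + K) * ?g + c * real K) / real n"
        by (rule divide_right_mono) simp
      then show ?thesis
        using that by (simp add: field_simps)
    qed
    ultimately have "C * 0 - h \<bullet> (a, 1 - a) - \<epsilon> \<le> ?g + (real K * ?g + c * real K) * 0"
      by (intro LIMSEQ_le) blast+
    then show ?thesis
      by simp
  qed
  then have "- (h \<bullet> (a, 1 - a)) \<le> g (a, 1 - a) + \<epsilon>" if "0 < \<epsilon>" for \<epsilon>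
    using that by (simp add: diff_le_eq)
  then show ?thesis
    unfolding h_def by (rule field_le_epsilon)
qed

text \<open>The first-step recursion says that the smaller of the two differences of passage times
  equals the weight at the origin once both neighbours lie below the endpoint; this identity
  survives the limit.\<close>

lemma cocycle_recovery:
  assumes a: "0 < a" "a < 1"
    and lim: "\<And>e. e \<in> {e1, e2} \<Longrightarrow> AE \<omega> in P.
      (\<lambda>n. lpp \<omega> 0 (direction_path a n) - lpp \<omega> e (direction_path a n)) \<longlonglongrightarrow> B \<omega> 0 e"
  shows "AE \<omega> in P. \<omega> 0 = min (B \<omega> 0 e1) (B \<omega> 0 e2)"
proof -
  have "AE \<omega> in P. (\<lambda>n. lpp \<omega> 0 (direction_path a n) - lpp \<omega> e1 (direction_path a n)) \<longlonglongrightarrow> B \<omega> 0 e1"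
    "AE \<omega> in P. (\<lambda>n. lpp \<omega> 0 (direction_path a n) - lpp \<omega> e2 (direction_path a n)) \<longlonglongrightarrow> B \<omega> 0 e2"
    using lim by auto
  then show ?thesis
  proof eventually_elim
    case (elim \<omega>)
    let ?u = "direction_path a"
    have "\<forall>\<^sub>F n in sequentially. min (lpp \<omega> 0 (?u n) - lpp \<omega> e1 (?u n)) (lpp \<omega> 0 (?u n) - lpp \<omega> e2 (?u n)) = \<omega> 0"
      using eventually_unit_le_direction_path[OF a]
    proof eventually_elim
      case (elim n)
      then have "lpp \<omega> 0 (?u n) = \<omega> 0 + max (lpp \<omega> e1 (?u n)) (lpp \<omega> e2 (?u n))"
        using lpp_eq_max[of 0 "?u n" \<omega>] by simp
      then show ?case
        by linarith
    qed
    then have "(\<lambda>n. min (lpp \<omega> 0 (?u n) - lpp \<omega> e1 (?u n)) (lpp \<omega> 0 (?u n) - lpp \<omega> e2 (?u n))) \<longlonglongrightarrow> \<omega> 0"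
      by (rule tendsto_eventually)
    then show ?case
      using tendsto_min[OF elim] LIMSEQ_unique by blast
  qed
qed

end

subsection \<open>The point-to-line constant\<close>

text \<open>Both coordinates of the optimal endpoint are rounded up to multiples of
  \<open>n / K\<close>. Almost monotonicity costs \<open>2 * c\<close>, the linear term
  \<open>\<bar>fst h\<bar> + \<bar>snd h\<bar>\<close> and the bound on the grid \<open>1\<close>,
  each over \<open>K\<close> after division by \<open>n\<close>. Rounding leaves the segment of
  directions, hence the grid of pairs.\<close>

lemma lpp_line_le_grid:
  assumes \<omega>: "\<And>x. - c \<le> \<omega> x" and c: "0 \<le> c" and n: "0 < n" and K: "0 < K"
    and grid: "\<And>i j. i \<le> Suc K \<Longrightarrow> j \<le> Suc K \<Longrightarrow>
      lpp \<omega> 0 (floor_vec (real n *\<^sub>R (real i / real K, real j / real K))) / real n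
        \<le> - (h \<bullet> (real i / real K, real j / real K)) + 1 / real K"
  shows "lpp_line \<omega> n (h + (t, t)) / real n \<le> t + (1 + 2 * c + \<bar>fst h\<bar> + \<bar>snd h\<bar>) / real K"
proof -
  have cell: "\<exists>i\<le>Suc K. real_of_int a \<le> real n * (real i / real K) \<and>
      real n * (real i / real K) \<le> real_of_int a + real n / real K" if a: "0 \<le> a" "a \<le> int n" for a
  proof -
    define k where "k = nat a"
    have k: "real_of_int a = real k" "k \<le> n"
      using a by (auto simp: k_def)
    \<comment> \<open>The cell index is \<open>Suc q\<close>, so the grid point is never below
      \<open>k\<close> and its index can reach \<open>Suc K\<close>.\<close>
    define q where "q = k * K div n"
    have "q \<le> K"
      using k(2) n unfolding q_def by (metis div_le_mono mult_le_mono1 nonzero_mult_div_cancel_left less_not_refl)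
    have "n * q \<le> k * K" "k * K < n * Suc q"
      using n unfolding q_def by (simp_all add: dividend_less_times_div)
    then have "real (n * q) \<le> real (k * K)" "real (k * K) \<le> real (n * Suc q)"
      by (simp_all only: of_nat_le_iff less_imp_le)
    then have "real k \<le> real n * (real (Suc q) / real K)"
      "real n * (real (Suc q) / real K) \<le> real k + real n / real K"
      using K by (simp_all add: field_simps)
    then show ?thesis
      using \<open>q \<le> K\<close> unfolding k(1) by (intro exI[of _ "Suc q"]) auto
  qed
  obtain x where x: "0 \<le> x" "l1norm x = int n"
    and line: "lpp_line \<omega> n (h + (t, t)) \<le> lpp \<omega> 0 x + (h + (t, t)) \<bullet> rvec x"
    by (rule lpp_line_le_lpp)
  have sum_x: "fst x + snd x = int n" and x0: "0 \<le> fst x" "0 \<le> snd x"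
    using x l1norm_nonneg_eq[OF x(1)] by (auto simp: less_eq_prod_def)
  obtain i where i: "i \<le> Suc K" "real_of_int (fst x) \<le> real n * (real i / real K)"
    "real n * (real i / real K) \<le> real_of_int (fst x) + real n / real K"
    using cell[of "fst x"] sum_x x0 by auto
  obtain j where j: "j \<le> Suc K" "real_of_int (snd x) \<le> real n * (real j / real K)"
    "real n * (real j / real K) \<le> real_of_int (snd x) + real n / real K"
    using cell[of "snd x"] sum_x x0 by auto
  define \<alpha> \<beta> \<delta> where "\<alpha> = real n * (real i / real K)" and "\<beta> = real n * (real j / real K)"
    and "\<delta> = real n / real K"
  note bounds = i(2,3) j(2,3)
  note bounds = bounds[folded \<alpha>_def \<beta>_def \<delta>_def]
  define y where "y = floor_vec (real n *\<^sub>R (real i / real K, real j / real K))"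
  have y: "y = (\<lfloor>\<alpha>\<rfloor>, \<lfloor>\<beta>\<rfloor>)"
    by (simp add: y_def floor_vec_def \<alpha>_def \<beta>_def)
  have "x \<le> y"
    using bounds by (simp add: y less_eq_prod_def le_floor_iff)
  have "real_of_int (l1norm (y - x)) = real_of_int (fst y - fst x) + real_of_int (snd y - snd x)"
    using \<open>x \<le> y\<close> by (simp add: l1norm_def less_eq_prod_def)
  also have "\<dots> \<le> 2 * \<delta>"
    using bounds of_int_floor_le[of \<alpha>] of_int_floor_le[of \<beta>]
    unfolding y fst_conv snd_conv of_int_diff by linarith
  finally have "c * real_of_int (l1norm (y - x)) \<le> c * (2 * \<delta>)"
    using c by (rule mult_left_mono)
  then have "lpp \<omega> 0 x \<le> lpp \<omega> 0 y + 2 * c * \<delta>"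
    using lpp_mono_endpoint[OF x(1) \<open>x \<le> y\<close>, of c \<omega>] \<omega> by (simp add: algebra_simps)
  also have "lpp \<omega> 0 y \<le> (- (h \<bullet> (real i / real K, real j / real K)) + 1 / real K) * real n"
    using grid[OF i(1) j(1), folded y_def] n by (simp only: pos_divide_le_eq of_nat_0_less_iff)
  also have "\<dots> = - (fst h * \<alpha> + snd h * \<beta>) + \<delta>"
    by (simp add: inner_prod_def \<alpha>_def \<beta>_def \<delta>_def algebra_simps)
  finally have "lpp \<omega> 0 x + (h + (t, t)) \<bullet> rvec x
      \<le> fst h * (real_of_int (fst x) - \<alpha>) + snd h * (real_of_int (snd x) - \<beta>)
        + \<delta> + 2 * c * \<delta> + t * (real_of_int (fst x) + real_of_int (snd x))"
    by (simp add: inner_prod_def rvec_def algebra_simps)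
  also have "fst h * (real_of_int (fst x) - \<alpha>) \<le> \<bar>fst h\<bar> * \<delta>"
  proof -
    have "\<bar>fst h * (real_of_int (fst x) - \<alpha>)\<bar> \<le> \<bar>fst h\<bar> * \<delta>"
      unfolding abs_mult using bounds by (intro mult_left_mono) auto
    then show ?thesis
      by linarith
  qed
  also have "snd h * (real_of_int (snd x) - \<beta>) \<le> \<bar>snd h\<bar> * \<delta>"
  proof -
    have "\<bar>snd h * (real_of_int (snd x) - \<beta>)\<bar> \<le> \<bar>snd h\<bar> * \<delta>"
      unfolding abs_mult using bounds by (intro mult_left_mono) auto
    then show ?thesis
      by linarith
  qed
  also have "real_of_int (fst x) + real_of_int (snd x) = real n"
    using arg_cong[OF sum_x, of real_of_int] by simp
  finally have "lpp_line \<omega> n (h + (t, t)) \<le> real n * t + (1 + 2 * c + \<bar>fst h\<bar> + \<bar>snd h\<bar>) * \<delta>"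
    using line by (simp add: algebra_simps)
  then have "lpp_line \<omega> n (h + (t, t)) / real n
      \<le> (real n * t + (1 + 2 * c + \<bar>fst h\<bar> + \<bar>snd h\<bar>) * \<delta>) / real n"
    by (rule divide_right_mono) simp
  also have "\<dots> = t + (1 + 2 * c + \<bar>fst h\<bar> + \<bar>snd h\<bar>) / real K"
    using n by (simp add: \<delta>_def add_divide_distrib)
  finally show ?thesis .
qed

context stationary_weights
begin

text \<open>The point-to-point limits hold almost surely for all rational grid directions at once.
  For fixed \<open>K\<close> only finitely many of them matter, so all are within
  \<open>1 / K\<close> for large \<open>n\<close>; then \<open>K\<close> tends to infinity.\<close>

lemma gpl_le:
  assumes g: "is_gpp P g" and gl: "is_gpl P gl"
    and le: "\<And>\<zeta>. 0 \<le> fst \<zeta> \<Longrightarrow> 0 \<le> snd \<zeta> \<Longrightarrow> g \<zeta> \<le> - (h \<bullet> \<zeta>)"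
  shows "gl (h + (t, t)) \<le> t"
proof -
  define D where "D = 1 + 2 * c + \<bar>fst h\<bar> + \<bar>snd h\<bar>"
  have "AE \<omega> in P. \<forall>K i j. (\<lambda>n. lpp \<omega> 0 (floor_vec (real n *\<^sub>R (real i / real K, real j / real K))) / real n)
      \<longlonglongrightarrow> g (real i / real K, real j / real K)"
    unfolding AE_all_countable by (intro allI is_gppD[OF g]) simp_all
  moreover have "AE \<omega> in P. (\<lambda>n. lpp_line \<omega> n (h + (t, t)) / real n) \<longlonglongrightarrow> gl (h + (t, t))"
    using gl unfolding is_gpl_def by blast
  ultimately have "AE \<omega> in P. gl (h + (t, t)) \<le> t"
    using weight_ge
  proof eventually_elim
    case (elim \<omega>)
    have "gl (h + (t, t)) \<le> t + D * (1 / real K)" if K: "0 < K" for K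
    proof -
      have "\<forall>\<^sub>F n in sequentially. \<forall>i\<in>{..Suc K}. \<forall>j\<in>{..Suc K}.
          lpp \<omega> 0 (floor_vec (real n *\<^sub>R (real i / real K, real j / real K))) / real n
            < g (real i / real K, real j / real K) + 1 / real K"
        using elim(1) K by (intro eventually_ball_finite ballI) (auto intro!: order_tendstoD(2))
      then have "\<forall>\<^sub>F n in sequentially. lpp_line \<omega> n (h + (t, t)) / real n \<le> t + D * (1 / real K)"
        using eventually_gt_at_top[of 0]
      proof eventually_elim
        case n: (elim n)
        have grid: "lpp \<omega> 0 (floor_vec (real n *\<^sub>R (real i / real K, real j / real K))) / real n
            \<le> - (h \<bullet> (real i / real K, real j / real K)) + 1 / real K"
          if "i \<le> Suc K" "j \<le> Suc K" for i j
        proof -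
          have "g (real i / real K, real j / real K) \<le> - (h \<bullet> (real i / real K, real j / real K))"
            by (rule le) simp_all
          moreover have "lpp \<omega> 0 (floor_vec (real n *\<^sub>R (real i / real K, real j / real K))) / real n
              < g (real i / real K, real j / real K) + 1 / real K"
            using n(1) that unfolding atMost_iff[symmetric] by blast
          ultimately show ?thesis
            by linarith
        qed
        have weight: "- c \<le> \<omega> x" for x
          using elim(3) by blast
        have "lpp_line \<omega> n (h + (t, t)) / real n \<le> t + (1 + 2 * c + \<bar>fst h\<bar> + \<bar>snd h\<bar>) / real K"
          by (rule lpp_line_le_grid[OF weight c_nonneg n(2) K grid])
        then show ?case
          by (simp add: D_def)
      qed
      then show ?thesis
        by (rule tendsto_upperbound[OF elim(2)]) simp
    qed
    then have "\<forall>K\<ge>1. gl (h + (t, t)) \<le> t + D * (1 / real K)"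
      by simp
    moreover have "(\<lambda>K. t + D * (1 / real K)) \<longlonglongrightarrow> t + D * 0"
      by (intro tendsto_intros lim_1_over_n)
    ultimately have "gl (h + (t, t)) \<le> t + D * 0"
      by (intro LIMSEQ_le_const) blast+
    then show ?case
      by simp
  qed
  then show ?thesis
    by simp
qed

text \<open>The best path to a rounded multiple of \<open>\<zeta>\<close> competes in the
  point-to-line maximum.\<close>

lemma gpl_ge:
  assumes g: "is_gpp P g" and gl: "is_gpl P gl"
    and \<zeta>: "0 \<le> fst \<zeta>" "0 \<le> snd \<zeta>" "fst \<zeta> + snd \<zeta> = 1"
  shows "g \<zeta> + h \<bullet> \<zeta> \<le> gl h"
proof -
  define v where "v n = floor_vec (real n *\<^sub>R \<zeta>)" for n
  \<comment> \<open>Rounding may shorten the path, so the number of steps to \<open>v n\<close> is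
    \<open>N n\<close> instead of \<open>n\<close>; the ratio of the two tends to one.\<close>
  define N where "N n = nat (l1norm (v n))" for n
  let ?w = "\<lambda>n. rvec (v n) /\<^sub>R real n"
  have v0: "0 \<le> v n" for n
    unfolding v_def using \<zeta>(1,2) by (rule floor_vec_nonneg)
  have w: "?w \<longlonglongrightarrow> \<zeta>"
    unfolding v_def by (rule tendsto_rvec_floor_vec)
  have real_N: "real (N n) = real_of_int (fst (v n)) + real_of_int (snd (v n))" for n
    using v0[of n] l1norm_nonneg_eq[OF v0[of n]] by (simp add: N_def less_eq_prod_def)
  have "(\<lambda>n. fst (?w n) + snd (?w n)) \<longlonglongrightarrow> fst \<zeta> + snd \<zeta>"
    by (intro tendsto_intros w)
  moreover have "fst (?w n) + snd (?w n) = real (N n) / real n" for n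
    by (simp add: real_N rvec_def divide_inverse algebra_simps)
  ultimately have N_div: "(\<lambda>n. real (N n) / real n) \<longlonglongrightarrow> 1"
    by (simp only: \<zeta>(3))
  have N_top: "filterlim N sequentially sequentially"
  proof -
    have "filterlim (\<lambda>n. real (N n) / real n * real n) at_top sequentially"
      by (rule filterlim_tendsto_pos_mult_at_top[OF N_div _ filterlim_real_sequentially]) simp
    moreover have "\<forall>\<^sub>F n in sequentially. real (N n) / real n * real n = real (N n)"
      using eventually_gt_at_top[of 0] by eventually_elim simp
    ultimately have "filterlim (\<lambda>n. real (N n)) at_top sequentially"
      by (rule filterlim_mono_eventually[OF _ order_refl order_refl])
    then show ?thesis
      using filterlim_sequentially_iff_filterlim_real by blast
  qed
  have "AE \<omega> in P. (\<lambda>n. lpp \<omega> 0 (v n) / real n) \<longlonglongrightarrow> g \<zeta>"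
    unfolding v_def by (rule is_gppD[OF g \<zeta>(1,2)])
  moreover have "AE \<omega> in P. (\<lambda>n. lpp_line \<omega> n h / real n) \<longlonglongrightarrow> gl h"
    using gl unfolding is_gpl_def by blast
  ultimately have "AE \<omega> in P. g \<zeta> + h \<bullet> \<zeta> \<le> gl h"
  proof eventually_elim
    case (elim \<omega>)
    have "(\<lambda>n. lpp \<omega> 0 (v n) / real n + h \<bullet> ?w n) \<longlonglongrightarrow> g \<zeta> + h \<bullet> \<zeta>"
      by (intro tendsto_intros w elim(1))
    moreover have "(\<lambda>n. lpp_line \<omega> (N n) h / real (N n) * (real (N n) / real n)) \<longlonglongrightarrow> gl h * 1"
      by (intro tendsto_mult N_div filterlim_compose[OF elim(2) N_top])
    moreover have "\<forall>\<^sub>F n in sequentially. lpp \<omega> 0 (v n) / real n + h \<bullet> ?w n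
        \<le> lpp_line \<omega> (N n) h / real (N n) * (real (N n) / real n)"
      using filterlim_at_top[THEN iffD1, rule_format, OF N_top, of 1]
    proof eventually_elim
      case (elim n)
      have "(lpp \<omega> 0 (v n) + h \<bullet> rvec (v n)) / real n \<le> lpp_line \<omega> (N n) h / real n"
        by (intro divide_right_mono lpp_line_ge_lpp v0) (simp_all add: N_def)
      moreover have "lpp \<omega> 0 (v n) / real n + h \<bullet> ?w n = (lpp \<omega> 0 (v n) + h \<bullet> rvec (v n)) / real n"
        by (simp add: divide_inverse algebra_simps)
      moreover have "lpp_line \<omega> (N n) h / real (N n) * (real (N n) / real n) = lpp_line \<omega> (N n) h / real n"
        using elim by simp
      ultimately show ?case
        by (simp only:)
    qed
    ultimately have "g \<zeta> + h \<bullet> \<zeta> \<le> gl h * 1"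
      using tendsto_le[OF sequentially_bot] by blast
    then show ?case
      by simp
  qed
  then show ?thesis
    by simp
qed

end

section \<open>Stationarity of i.i.d. weights, essential suprema and coordinates of
  directions\<close>

text \<open>Independence with identical marginals makes \<open>P\<close> a product of copies of one
  law, and such a product is preserved by the injective reindexing of coordinates.\<close>

lemma distr_translate_iid:
  fixes P :: "env measure"
  assumes "prob_space P" and sets: "sets P = sets borel"
    and indep: "prob_space.indep_vars P (\<lambda>_. borel) (\<lambda>x \<omega>. \<omega> x) (UNIV :: site set)"
    and ident: "\<And>x. distr P borel (\<lambda>\<omega>. \<omega> x) = distr P borel (\<lambda>\<omega>. \<omega> 0)"
  shows "distr P P (translate z) = P"
proof -
  interpret prob_space P by fact
  define \<mu> where "\<mu> = distr P borel (\<lambda>\<omega>. \<omega> 0)"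
  have coord: "(\<lambda>\<omega>. \<omega> x) \<in> borel_measurable P" for x
  proof -
    have "(\<lambda>\<omega>. \<omega> x) \<in> borel_measurable (borel :: env measure)"
      by (rule borel_measurable_continuous_onI[OF continuous_on_product_coordinates])
    then show ?thesis
      by (simp only: measurable_cong_sets[OF sets refl])
  qed
  interpret \<mu>: prob_space \<mu>
    unfolding \<mu>_def using coord by (rule prob_space_distr)
  have sets_PiM: "sets (\<Pi>\<^sub>M x\<in>(UNIV :: site set). (borel :: real measure)) = sets P"
    by (simp add: sets sets_PiM_equal_borel)
  have "distr P (\<Pi>\<^sub>M x\<in>(UNIV :: site set). borel) (\<lambda>\<omega>. \<lambda>x\<in>UNIV. \<omega> x)
      = (\<Pi>\<^sub>M x\<in>(UNIV :: site set). distr P borel (\<lambda>\<omega>. \<omega> x))"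
    using indep coord by (subst (asm) indep_vars_iff_distr_eq_PiM) auto
  then have P: "P = (\<Pi>\<^sub>M x\<in>(UNIV :: site set). \<mu>)"
    using distr_id2[OF sets_PiM] by (simp add: ident[folded \<mu>_def] restrict_def)
  have "distr (\<Pi>\<^sub>M x\<in>(UNIV :: site set). \<mu>) (\<Pi>\<^sub>M x\<in>(UNIV :: site set). \<mu>)
      (\<lambda>\<omega>. \<lambda>x\<in>UNIV. \<omega> (z + x)) = (\<Pi>\<^sub>M x\<in>(UNIV :: site set). \<mu>)"
    by (rule distr_PiM_reindex) (auto simp: inj_on_def \<mu>.prob_space_axioms)
  then show ?thesis
    unfolding P[symmetric] by (simp add: translate_def[abs_def] restrict_def)
qed

text \<open>Real almost sure upper bounds suffice, also when the essential supremum is infinite,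
  because an extended real is determined by the reals above it.\<close>

lemma (in prob_space) ereal_le_esssup:
  assumes "\<And>s. AE x in M. f x \<le> s \<Longrightarrow> t \<le> s"
  shows "ereal t \<le> esssup M (\<lambda>x. ereal (f x))"
proof (rule ereal_le_real)
  fix s assume s: "esssup M (\<lambda>x. ereal (f x)) \<le> ereal s"
  have "AE x in M. f x \<le> s"
    using esssup_AE[where M = M and f = "\<lambda>x. ereal (f x)"] by eventually_elim (use s order_trans in force)
  then show "ereal t \<le> ereal s"
    using assms by simp
qed

lemma rel_interior_directions:
  "rel_interior directions = {(a, 1 - a) | a. 0 < a \<and> a < 1}"
proof -
  have "directions = closed_segment (0, 1) (1, 0)"
    by (auto simp: directions_def closed_segment_def rvec_def e1_def e2_def)
  then have "rel_interior directions = rel_interior (closed_segment (0, 1) (1, 0))"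
    by simp
  also have "\<dots> = open_segment (0, 1) (1, 0)"
    unfolding rel_interior_closed_segment by simp
  also have "\<dots> = {(a, 1 - a) | a. 0 < a \<and> a < 1}"
    by (auto simp: in_segment)
  finally show ?thesis .
qed

subsection \<open>The variational formulas\<close>

context stationary_weights
begin

text \<open>Reflecting \<open>F\<close> at \<open>h\<close> turns the bound \<open>s\<close> into
  domination of the weight by a cocycle with vector \<open>h\<close>.\<close>

lemma gpp_le_of_centered_cocycle:
  assumes F: "F \<in> centered_cocycles P" and g: "is_gpp P g"
    and \<zeta>: "0 \<le> fst \<zeta>" "0 \<le> snd \<zeta>" "fst \<zeta> + snd \<zeta> = 1"
    and s: "AE \<omega> in P. pl_functional h F \<omega> \<le> s"
  shows "g \<zeta> + h \<bullet> \<zeta> \<le> s"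
proof -
  define B where "B = (\<lambda>\<omega> x y. h \<bullet> rvec (x - y) - F \<omega> x y)"
  have B: "B \<in> cocycles P" "hvec P B = h"
    using reflected_cocycle[of F h] F unfolding centered_cocycle_iff B_def by auto
  have "AE \<omega> in P. \<forall>e\<in>{e1, e2}. \<omega> 0 \<le> s + B \<omega> 0 e"
    using s
  proof eventually_elim
    case (elim \<omega>)
    then have "\<omega> 0 + h \<bullet> rvec e + F \<omega> 0 e \<le> s" if "e \<in> {e1, e2}" for e
      using that by (auto simp: pl_functional_def)
    then show ?case
      by (fastforce simp: B_def rvec_diff)
  qed
  from gpp_le_cocycle[OF B(1) this g \<zeta>(1,2)] show ?thesis
    using \<zeta>(3) B(2) by simp
qed

text \<open>The domination constant is \<open>s + hvec P B \<bullet> \<zeta>\<close>; as the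
  coordinates of \<open>\<zeta>\<close> add up to one, the inner product cancels in the bound on
  \<open>g \<zeta>\<close>.\<close>

lemma gpp_le_of_cocycle:
  assumes B: "B \<in> cocycles P" and g: "is_gpp P g"
    and \<zeta>: "0 \<le> fst \<zeta>" "0 \<le> snd \<zeta>" "fst \<zeta> + snd \<zeta> = 1"
    and s: "AE \<omega> in P. pp_functional P \<zeta> B \<omega> \<le> s"
  shows "g \<zeta> \<le> s"
proof -
  have "AE \<omega> in P. \<forall>e\<in>{e1, e2}. \<omega> 0 \<le> (s + hvec P B \<bullet> \<zeta>) + B \<omega> 0 e"
    using s
  proof eventually_elim
    case (elim \<omega>)
    then have "\<omega> 0 - B \<omega> 0 e - hvec P B \<bullet> \<zeta> \<le> s" if "e \<in> {e1, e2}" for e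
      using that by (auto simp: pp_functional_def)
    then show ?case
      by (fastforce simp: algebra_simps)
  qed
  from gpp_le_cocycle[OF B this g \<zeta>(1,2)] show ?thesis
    using \<zeta>(3) by simp
qed

end

lemma (in prob_space) esssup_AE_eq:
  assumes "f \<in> borel_measurable M" "AE x in M. f x = t"
  shows "esssup M (\<lambda>x. ereal (f x)) = ereal t"
proof (rule antisym)
  show "esssup M (\<lambda>x. ereal (f x)) \<le> ereal t"
    using assms by (intro esssup_I) auto
  show "ereal t \<le> esssup M (\<lambda>x. ereal (f x))"
  proof (rule ereal_le_esssup)
    fix s assume "AE x in M. f x \<le> s"
    with assms(2) have "AE x in M. t \<le> s"
      by eventually_elim simp
    then show "t \<le> s"
      by simp
  qed
qed

text \<open>The difference between \<open>g\<close> and the linear function has a maximum over the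
  open quadrant at \<xi>, so its derivative there vanishes.\<close>

lemma gradient_eq_of_touching_linear:
  assumes diff: "g differentiable (at \<xi>)" and pos: "0 < fst \<xi>" "0 < snd \<xi>"
    and le: "\<And>\<zeta>. 0 \<le> fst \<zeta> \<Longrightarrow> 0 \<le> snd \<zeta> \<Longrightarrow> g \<zeta> \<le> v \<bullet> \<zeta>" and eq: "g \<xi> = v \<bullet> \<xi>"
  shows "gradient g \<xi> = v"
proof -
  let ?S = "{0<..} \<times> {0<..} :: (real \<times> real) set"
  have "((\<lambda>\<zeta>. g \<zeta> - v \<bullet> \<zeta>) has_derivative (\<lambda>\<zeta>. frechet_derivative g (at \<xi>) \<zeta> - v \<bullet> \<zeta>)) (at \<xi>)"
    using diff[unfolded frechet_derivative_works] by (intro derivative_intros) auto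
  then have "(\<lambda>\<zeta>. frechet_derivative g (at \<xi>) \<zeta> - v \<bullet> \<zeta>) = (\<lambda>_. 0)"
  proof (rule differential_zero_maxmin[rotated 2])
    show "\<xi> \<in> ?S"
      using pos by (simp add: mem_Times_iff)
    show "open ?S"
      by (intro open_Times open_greaterThan)
    show "(\<forall>\<zeta>\<in>?S. g \<zeta> - v \<bullet> \<zeta> \<le> g \<xi> - v \<bullet> \<xi>) \<or> (\<forall>\<zeta>\<in>?S. g \<xi> - v \<bullet> \<xi> \<le> g \<zeta> - v \<bullet> \<zeta>)"
      using le eq by (auto simp: less_imp_le)
  qed
  then have "frechet_derivative g (at \<xi>) \<zeta> = v \<bullet> \<zeta>" for \<zeta>
    by (metis eq_iff_diff_eq_0)
  then show ?thesis
    by (simp add: gradient_def inner_rvec_e)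
qed

theorem theorem2p3:
  fixes P :: "env measure"
    and gpp gpl :: "real \<times> real \<Rightarrow> real"
    and p c :: real
    and \<xi> \<xi>l \<xi>r :: "real \<times> real"
    and B F :: cocycle
  assumes "prob_space P"
    and "sets P = sets borel"
    and "prob_space.indep_vars P (\<lambda>_. borel) (\<lambda>x \<omega>. \<omega> x) (UNIV :: site set)"
    and "\<And>x. distr P borel (\<lambda>\<omega>. \<omega> x) = distr P borel (\<lambda>\<omega>. \<omega> 0)"
    and "p > 2"
    and "integrable P (\<lambda>\<omega>. \<bar>\<omega> 0\<bar> powr p)"
    and "prob_space.variance P (\<lambda>\<omega>. \<omega> 0) > 0"
    and "measure P {\<omega>. \<omega> 0 \<ge> c} = 1"
    and "is_gpp P gpp"
    and "is_gpl P gpl"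
    and "\<xi> \<in> rel_interior directions"
    and "linear_piece gpp \<xi> = closed_segment \<xi>l \<xi>r"
    and "\<xi>l \<bullet> rvec e1 \<le> \<xi>r \<bullet> rvec e1"
    and "\<xi>l \<in> diff_directions gpp"
    and "\<xi> \<in> diff_directions gpp"
    and "\<xi>r \<in> diff_directions gpp"
    and "B \<in> cocycles P"
    and "busemann_limit P \<xi>l \<xi>r B"
    and "F = (\<lambda>\<omega> x y. hvec P B \<bullet> rvec (x - y) - B \<omega> x y)"
  shows "hvec P B = - gradient gpp \<xi> \<and>
    (\<forall>t. let h = hvec P B + (t, t) in
      (AE \<omega> in P. gpl h = pl_functional h F \<omega> \<and> pl_functional h F \<omega> = t) \<and>
      F \<in> centered_cocycles P \<and>
      ereal (gpl h) = (INF F'\<in>centered_cocycles P. esssup P (\<lambda>\<omega>. ereal (pl_functional h F' \<omega>))) \<and>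
      esssup P (\<lambda>\<omega>. ereal (pl_functional h F \<omega>)) =
        (INF F'\<in>centered_cocycles P. esssup P (\<lambda>\<omega>. ereal (pl_functional h F' \<omega>)))) \<and>
    (AE \<omega> in P. gpp \<xi> = pp_functional P \<xi> B \<omega>) \<and>
    ereal (gpp \<xi>) = (INF B'\<in>cocycles P. esssup P (\<lambda>\<omega>. ereal (pp_functional P \<xi> B' \<omega>))) \<and>
    esssup P (\<lambda>\<omega>. ereal (pp_functional P \<xi> B \<omega>)) =
      (INF B'\<in>cocycles P. esssup P (\<lambda>\<omega>. ereal (pp_functional P \<xi> B' \<omega>)))"
proof -

  \<comment> \<open>Reduction to stationary weights\<close>
  interpret prob_space P by fact
  have coord: "(\<lambda>\<omega>. \<omega> 0) \<in> borel_measurable P"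
    using assms(3) unfolding indep_vars_def by blast
  \<comment> \<open>The bound \<open>c\<close> may have either sign, whereas the locale wants a
    nonnegative constant; \<open>- \<bar>c\<bar>\<close> lies below \<open>c\<close> in both
    cases.\<close>
  interpret stationary_weights P "\<bar>c\<bar>"
  proof
    show "sets P = sets borel" by fact
    show "distr P P (translate z) = P" for z
      by (rule distr_translate_iid[OF assms(1-4)])
    show "integrable P (\<lambda>\<omega>. \<omega> 0)"
    proof (rule Bochner_Integration.integrable_bound)
      show "integrable P (\<lambda>\<omega>. 1 + \<bar>\<omega> 0\<bar> powr p)"
        using assms(6) by simp
      show "AE \<omega> in P. norm (\<omega> 0) \<le> norm (1 + \<bar>\<omega> 0\<bar> powr p)"
      proof (rule AE_I2)
        fix \<omega> :: env
        have "\<bar>\<omega> 0\<bar> \<le> 1 + \<bar>\<omega> 0\<bar> powr p"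
        proof (cases "\<bar>\<omega> 0\<bar> \<le> 1")
          case False
          then have "\<bar>\<omega> 0\<bar> powr 1 \<le> \<bar>\<omega> 0\<bar> powr p"
            using assms(5) by (intro powr_mono) auto
          then show ?thesis
            using False by simp
        qed (simp add: add_increasing2)
        then show "norm (\<omega> 0) \<le> norm (1 + \<bar>\<omega> 0\<bar> powr p)"
          by simp
      qed
    qed (rule coord)
    have "AE \<omega> in P. c \<le> \<omega> 0"
      using AE_prob_1[OF assms(8)] by simp
    then show "AE \<omega> in P. - \<bar>c\<bar> \<le> \<omega> 0"
      by eventually_elim linarith
  qed simp

  \<comment> \<open>Busemann limits in direction \<xi>\<close>
  define h where "h = hvec P B"
  obtain a where a: "0 < a" "a < 1" and \<xi>: "\<xi> = (a, 1 - a)"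
    using assms(11) by (auto simp: rel_interior_directions)
  have \<xi>_pos: "0 \<le> fst \<xi>" "0 \<le> snd \<xi>" "fst \<xi> + snd \<xi> = 1"
    using a by (auto simp: \<xi>)
  \<comment> \<open>Both sides of the defining equation vanish at \<xi>. Hence \<xi> lies on the
    segment from \<open>\<xi>l\<close> to \<open>\<xi>r\<close>, and \<open>direction_path a\<close>
    is an admissible sequence for the Busemann limit.\<close>
  have "\<xi> \<in> linear_piece gpp \<xi>"
    using assms(11) by (simp add: linear_piece_def linear_piece_side_def)
  then obtain s where s: "0 \<le> s" "s \<le> 1" "\<xi> = (1 - s) *\<^sub>R \<xi>l + s *\<^sub>R \<xi>r"
    using assms(12) by (auto simp: closed_segment_def)
  have a_between: "fst \<xi>l \<le> a" "a \<le> fst \<xi>r"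
  proof -
    have ordered: "fst \<xi>l \<le> fst \<xi>r"
      using assms(13) by (simp add: inner_rvec_e)
    have "a = fst \<xi>l + s * (fst \<xi>r - fst \<xi>l)" "a = fst \<xi>r - (1 - s) * (fst \<xi>r - fst \<xi>l)"
      using arg_cong[OF s(3), of fst] by (simp_all add: \<xi> algebra_simps)
    moreover have "0 \<le> s * (fst \<xi>r - fst \<xi>l)" "0 \<le> (1 - s) * (fst \<xi>r - fst \<xi>l)"
      using ordered s(1,2) by simp_all
    ultimately show "fst \<xi>l \<le> a" "a \<le> fst \<xi>r"
      by linarith+
  qed
  have busemann: "AE \<omega> in P. (\<lambda>n. lpp \<omega> 0 (direction_path a n) - lpp \<omega> e (direction_path a n)) \<longlonglongrightarrow> B \<omega> 0 e"
    if "e \<in> {e1, e2}" for e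
  proof -
    let ?u = "direction_path a"
    have ratio: "(\<lambda>n. ereal (rvec (?u n) \<bullet> rvec e1 / real_of_int (l1norm (?u n)))) \<longlonglongrightarrow> ereal a"
    proof -
      have "fst (rvec x) = real_of_int (fst x)" for x
        by (simp add: rvec_def)
      then show ?thesis
        using tendsto_fst_direction_path[of a] by (simp add: inner_rvec_e l1norm_direction_path[OF a])
    qed
    have nonneg: "\<forall>n. 0 \<le> fst (?u n) \<and> 0 \<le> snd (?u n)"
      using direction_path_nonneg[OF a] by (simp add: less_eq_prod_def)
    have top: "filterlim (\<lambda>n. l1norm (?u n)) at_top sequentially"
      by (simp add: l1norm_direction_path[OF a] filterlim_int_sequentially)
    have lower: "ereal (\<xi>l \<bullet> rvec e1) \<le> liminf (\<lambda>n. ereal (rvec (?u n) \<bullet> rvec e1 / real_of_int (l1norm (?u n))))"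
      using a_between(1) lim_imp_Liminf[OF sequentially_bot ratio] by (simp add: inner_rvec_e)
    have upper: "limsup (\<lambda>n. ereal (rvec (?u n) \<bullet> rvec e1 / real_of_int (l1norm (?u n)))) \<le> ereal (\<xi>r \<bullet> rvec e1)"
      using a_between(2) lim_imp_Limsup[OF sequentially_bot ratio] by (simp add: inner_rvec_e)
    show ?thesis
      using assms(18) unfolding busemann_limit_def
    proof eventually_elim
      case (elim \<omega>)
      note limits = elim[THEN spec, of 0, THEN spec, of e, THEN spec, of ?u]
      from limits[THEN mp, OF nonneg, THEN mp, OF top, THEN mp, OF lower, THEN mp, OF upper]
      show ?case .
    qed
  qed

  \<comment> \<open>The touching linear function and the gradient\<close>
  have recovery: "AE \<omega> in P. \<omega> 0 = min (B \<omega> 0 e1) (B \<omega> 0 e2)"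
    by (rule cocycle_recovery[where B = B, OF a busemann])
  then have dom: "AE \<omega> in P. \<forall>e\<in>{e1, e2}. \<omega> 0 \<le> 0 + B \<omega> 0 e"
    by eventually_elim auto
  \<comment> \<open>Recovery dominates the weight by the cocycle itself, so the general upper bound
    applies with constant zero.\<close>
  have gpp_le: "gpp \<zeta> \<le> - (h \<bullet> \<zeta>)" if "0 \<le> fst \<zeta>" "0 \<le> snd \<zeta>" for \<zeta>
    using gpp_le_cocycle[OF assms(17) dom assms(9) that] by (simp add: h_def)
  have gpp_\<xi>: "gpp \<xi> = - (h \<bullet> \<xi>)"
    using gpp_le[OF \<xi>_pos(1,2)] cocycle_le_gpp[OF assms(17,9) a busemann] by (simp add: h_def \<xi>)
  have "gpp differentiable (at \<xi>)"
    using assms(15) by (simp add: diff_directions_def)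
  then have "gradient gpp \<xi> = - h"
    using a gpp_le gpp_\<xi> by (intro gradient_eq_of_touching_linear) (auto simp: \<xi>)
  then have gradient: "hvec P B = - gradient gpp \<xi>"
    by (simp add: h_def)

  \<comment> \<open>The point-to-line formula\<close>
  have F: "F \<in> centered_cocycles P"
    unfolding centered_cocycle_iff assms(19) using reflected_cocycle[OF assms(17), of "hvec P B"] by simp
  have measurable_B: "(\<lambda>\<omega>. B \<omega> 0 e) \<in> borel_measurable P" for e
    by (rule measurable_cocycle[OF assms(17)])
  have point_to_line: "(AE \<omega> in P. gpl k = pl_functional k F \<omega> \<and> pl_functional k F \<omega> = t) \<and>
      F \<in> centered_cocycles P \<and>
      ereal (gpl k) = (INF F'\<in>centered_cocycles P. esssup P (\<lambda>\<omega>. ereal (pl_functional k F' \<omega>))) \<and>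
      esssup P (\<lambda>\<omega>. ereal (pl_functional k F \<omega>)) =
        (INF F'\<in>centered_cocycles P. esssup P (\<lambda>\<omega>. ereal (pl_functional k F' \<omega>)))"
    if k: "k = hvec P B + (t, t)" for t k
  proof -
    \<comment> \<open>Adding \<open>(t, t)\<close> to the vector adds \<open>t\<close> to its inner
      product with a direction whose coordinates sum to one. This identifies both the value of
      \<open>gpl k\<close> and the lower bound for all competitors.\<close>
    have k\<xi>: "gpp \<xi> + k \<bullet> \<xi> = t"
      using gpp_\<xi> by (simp add: k h_def inner_add_left \<xi> algebra_simps)
    have "gpl k \<le> t"
      using gpl_le[OF assms(9,10) gpp_le, of t] by (simp add: k h_def)
    moreover have "t \<le> gpl k"
      using gpl_ge[OF assms(9,10) \<xi>_pos, of k] k\<xi> by simp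
    ultimately have gpl: "gpl k = t"
      by simp
    \<comment> \<open>Recovery cancels everything but \<open>t\<close> in this form; it also
      displays the functional as measurable.\<close>
    have pl: "pl_functional k F \<omega> = \<omega> 0 + t - min (B \<omega> 0 e1) (B \<omega> 0 e2)" for \<omega>
    proof -
      have "pl_functional k F \<omega>
          = max (\<omega> 0 + k \<bullet> rvec e1 + F \<omega> 0 e1) (\<omega> 0 + k \<bullet> rvec e2 + F \<omega> 0 e2)"
        by (simp add: pl_functional_def)
      moreover have "k \<bullet> rvec e1 + F \<omega> 0 e1 = t - B \<omega> 0 e1" "k \<bullet> rvec e2 + F \<omega> 0 e2 = t - B \<omega> 0 e2"
        by (simp_all add: k assms(19) rvec_diff inner_rvec_e)
      ultimately show ?thesis
        by linarith
    qed
    have AE_t: "AE \<omega> in P. pl_functional k F \<omega> = t"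
      using recovery by eventually_elim (simp add: pl)
    have esssup_F: "esssup P (\<lambda>\<omega>. ereal (pl_functional k F \<omega>)) = ereal t"
      using coord measurable_B AE_t by (intro esssup_AE_eq) (simp_all add: pl)
    have "(INF F'\<in>centered_cocycles P. esssup P (\<lambda>\<omega>. ereal (pl_functional k F' \<omega>))) = ereal t"
    proof (rule antisym)
      show "(INF F'\<in>centered_cocycles P. esssup P (\<lambda>\<omega>. ereal (pl_functional k F' \<omega>))) \<le> ereal t"
        using INF_lower[OF F, of "\<lambda>F'. esssup P (\<lambda>\<omega>. ereal (pl_functional k F' \<omega>))"] esssup_F by simp
      show "ereal t \<le> (INF F'\<in>centered_cocycles P. esssup P (\<lambda>\<omega>. ereal (pl_functional k F' \<omega>)))"
      proof (intro INF_greatest ereal_le_esssup)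
        fix F' s assume "F' \<in> centered_cocycles P" "AE \<omega> in P. pl_functional k F' \<omega> \<le> s"
        from gpp_le_of_centered_cocycle[OF this(1) assms(9) \<xi>_pos this(2)] show "t \<le> s"
          by (simp only: k\<xi>)
      qed
    qed
    moreover have "AE \<omega> in P. gpl k = pl_functional k F \<omega> \<and> pl_functional k F \<omega> = t"
      using AE_t unfolding gpl by eventually_elim simp
    ultimately show ?thesis
      using F esssup_F gpl by metis
  qed

  \<comment> \<open>The point-to-point formula\<close>
  have pp: "pp_functional P \<xi> B \<omega> = \<omega> 0 + gpp \<xi> - min (B \<omega> 0 e1) (B \<omega> 0 e2)" for \<omega>
  proof -
    have "pp_functional P \<xi> B \<omega> = max (\<omega> 0 - B \<omega> 0 e1 - h \<bullet> \<xi>) (\<omega> 0 - B \<omega> 0 e2 - h \<bullet> \<xi>)"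
      by (simp add: pp_functional_def h_def)
    then show ?thesis
      using gpp_\<xi> by linarith
  qed
  have AE_gpp: "AE \<omega> in P. pp_functional P \<xi> B \<omega> = gpp \<xi>"
    using recovery by eventually_elim (simp add: pp)
  have esssup_B: "esssup P (\<lambda>\<omega>. ereal (pp_functional P \<xi> B \<omega>)) = ereal (gpp \<xi>)"
    using coord measurable_B AE_gpp by (intro esssup_AE_eq) (simp_all add: pp)
  have "(INF B'\<in>cocycles P. esssup P (\<lambda>\<omega>. ereal (pp_functional P \<xi> B' \<omega>))) = ereal (gpp \<xi>)"
  proof (rule antisym)
    show "(INF B'\<in>cocycles P. esssup P (\<lambda>\<omega>. ereal (pp_functional P \<xi> B' \<omega>))) \<le> ereal (gpp \<xi>)"
      using INF_lower[OF assms(17), of "\<lambda>B'. esssup P (\<lambda>\<omega>. ereal (pp_functional P \<xi> B' \<omega>))"]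
        esssup_B by simp
    show "ereal (gpp \<xi>) \<le> (INF B'\<in>cocycles P. esssup P (\<lambda>\<omega>. ereal (pp_functional P \<xi> B' \<omega>)))"
    proof (intro INF_greatest ereal_le_esssup)
      fix B' s assume "B' \<in> cocycles P" "AE \<omega> in P. pp_functional P \<xi> B' \<omega> \<le> s"
      from gpp_le_of_cocycle[OF this(1) assms(9) \<xi>_pos this(2)] show "gpp \<xi> \<le> s" .
    qed
  qed
  moreover have "AE \<omega> in P. gpp \<xi> = pp_functional P \<xi> B \<omega>"
    using AE_gpp by eventually_elim simp
  moreover have "\<forall>t. let h = hvec P B + (t, t) in
      (AE \<omega> in P. gpl h = pl_functional h F \<omega> \<and> pl_functional h F \<omega> = t) \<and>
      F \<in> centered_cocycles P \<and>
      ereal (gpl h) = (INF F'\<in>centered_cocycles P. esssup P (\<lambda>\<omega>. ereal (pl_functional h F' \<omega>))) \<and>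
      esssup P (\<lambda>\<omega>. ereal (pl_functional h F \<omega>)) =
        (INF F'\<in>centered_cocycles P. esssup P (\<lambda>\<omega>. ereal (pl_functional h F' \<omega>)))"
    unfolding Let_def using point_to_line by blast
  ultimately show ?thesis
    using gradient esssup_B by simp
qed

end
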